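(* Let $S=K[x_1,\ldots,x_n]$ be a polynomial ring over a field $K$, let $I$ be a (proper) monomial ideal of $S$, and let $d=\dim(S/I)$. Let $f_i=\sum_{j=1}^n a_{i,j}x_j$ with $a_{i,j}\in K$, for $i=1,\ldots,d$. Then $\{f_1,\ldots,f_d\}$ is a system of parameters for $S/I$ if and only if for each minimal prime $\mathfrak{p}$ of $I$ the submatrix $$A_{\mathfrak{p}}:=(a_{i,j})_{x_j\notin\mathfrak{p}}$$ of size $d\times(n-\mathrm{ht}(\mathfrak{p}))$ of the $d\times n$ matrix $A:=(a_{i,j})$ has full column rank (i.e. its rank equals its number of columns $n-\mathrm{ht}(\mathfrak{p})$).
   Context: $S$ has the standard grading and $\mathfrak{m}=(x_1,\ldots,x_n)$. For a monomial ideal $I$ of $S$, homogeneous polynomials $f_1,\ldots,f_d\in S$ form a system of parameters for $S/I$ if $d=\dim(S/I)$ (Krull dimension) and $\mathrm{rad}(I,f_1,\ldots,f_d)=\mathfrak{m}$. Every minimal prime of a monomial ideal is generated by a subset of the variables. The matrix $A_{\mathfrak p}$ consists of the columns of $A$ indexed by those $j$ with $x_j\notin\mathfrak p$, and $\mathrm{ht}(\mathfrak p)$ is the height of $\mathfrak p$. *)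

theory Defs
  imports
    "HOL-Library.Poly_Mapping"
    "HOL-Library.Extended_Nat"
    "HOL-Algebra.QuotRing"
    "Jordan_Normal_Form.DL_Rank"
    "Jordan_Normal_Form.DL_Submatrix"
begin

section \<open>The polynomial ring\<close>

text \<open>
  A polynomial is a finitely supported map from exponent vectors to coefficients, and
  multiplication on \<^typ>\<open>(nat \<Rightarrow>\<^sub>0 nat) \<Rightarrow>\<^sub>0 'k\<close> is convolution.  The variables are
  \<open>x\<^sub>0, \<dots>, x\<^sub>n\<^sub>-\<^sub>1\<close> (indices start at 0, as for the matrices); the carrier restricts the
  polynomials in countably many variables to those involving only these.
\<close>

definition mpoly_ring :: "nat \<Rightarrow> ((nat \<Rightarrow>\<^sub>0 nat) \<Rightarrow>\<^sub>0 'k::field) ring" where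
  "mpoly_ring n =
    \<lparr>carrier = {f. \<forall>u\<in>Poly_Mapping.keys f. Poly_Mapping.keys u \<subseteq> {..<n}},
     monoid.mult = (*), one = 1, ring.zero = 0, add = (+)\<rparr>"

definition monomial :: "(nat \<Rightarrow>\<^sub>0 nat) \<Rightarrow> (nat \<Rightarrow>\<^sub>0 nat) \<Rightarrow>\<^sub>0 'k::field" where
  "monomial u = Poly_Mapping.single u 1"

definition var :: "nat \<Rightarrow> (nat \<Rightarrow>\<^sub>0 nat) \<Rightarrow>\<^sub>0 'k::field" where
  "var j = monomial (Poly_Mapping.single j 1)"

definition const :: "'k \<Rightarrow> (nat \<Rightarrow>\<^sub>0 nat) \<Rightarrow>\<^sub>0 'k::field" where
  "const c = Poly_Mapping.single 0 c"

definition mdeg :: "(nat \<Rightarrow>\<^sub>0 nat) \<Rightarrow> nat" where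
  "mdeg u = (\<Sum>j\<in>Poly_Mapping.keys u. Poly_Mapping.lookup u j)"

text \<open>The zero polynomial is homogeneous of every degree.\<close>

definition homogeneous :: "((nat \<Rightarrow>\<^sub>0 nat) \<Rightarrow>\<^sub>0 'k::field) \<Rightarrow> bool" where
  "homogeneous f \<longleftrightarrow> (\<exists>e. \<forall>u\<in>Poly_Mapping.keys f. mdeg u = e)"

text \<open>The zero ideal (\<open>M = {}\<close>) and the unit ideal are monomial ideals.\<close>

definition monomial_ideal :: "nat \<Rightarrow> ((nat \<Rightarrow>\<^sub>0 nat) \<Rightarrow>\<^sub>0 'k::field) set \<Rightarrow> bool" where
  "monomial_ideal n I \<longleftrightarrow>
    (\<exists>M. (\<forall>u\<in>M. Poly_Mapping.keys u \<subseteq> {..<n}) \<and> I = genideal (mpoly_ring n) (monomial ` M))"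

definition irrelevant_ideal :: "nat \<Rightarrow> ((nat \<Rightarrow>\<^sub>0 nat) \<Rightarrow>\<^sub>0 'k::field) set" where
  "irrelevant_ideal n = genideal (mpoly_ring n) (var ` {..<n})"


section \<open>Prime ideals, height, dimension\<close>

definition radical :: "('a, 'b) ring_scheme \<Rightarrow> 'a set \<Rightarrow> 'a set" where
  "radical R J = {a \<in> carrier R. \<exists>k::nat. a [^]\<^bsub>R\<^esub> k \<in> J}"

definition minimal_primes :: "('a, 'b) ring_scheme \<Rightarrow> 'a set \<Rightarrow> 'a set set" where
  "minimal_primes R I =
    {P. primeideal P R \<and> I \<subseteq> P \<and> (\<forall>Q. primeideal Q R \<and> I \<subseteq> Q \<and> Q \<subseteq> P \<longrightarrow> Q = P)}"

text \<open>
  A chain of primes is a nonempty list \<open>[P\<^sub>0, \<dots>, P\<^sub>r]\<close> with \<open>P\<^sub>0 \<subset> \<dots> \<subset> P\<^sub>r\<close>; its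
  length in the sense of commutative algebra is \<open>r\<close>.
\<close>

definition prime_chain :: "('a, 'b) ring_scheme \<Rightarrow> 'a set list \<Rightarrow> bool" where
  "prime_chain R Ps \<longleftrightarrow> Ps \<noteq> [] \<and> (\<forall>P\<in>set Ps. primeideal P R) \<and> sorted_wrt (\<subset>) Ps"

definition height :: "('a, 'b) ring_scheme \<Rightarrow> 'a set \<Rightarrow> enat" where
  "height R P = (SUP Ps\<in>{Ps. prime_chain R Ps \<and> last Ps = P}. enat (length Ps - 1))"

text \<open>The zero ring, which has no primes, gets dimension 0 here.\<close>

definition krull_dim :: "('a, 'b) ring_scheme \<Rightarrow> enat" where
  "krull_dim R = (SUP Ps\<in>{Ps. prime_chain R Ps}. enat (length Ps - 1))"


section \<open>Systems of parameters and their matrix criterion\<close>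

text \<open>A list is used so that \<open>f\<^sub>1, \<dots>, f\<^sub>d\<close> may contain repetitions.\<close>

definition system_of_parameters ::
    "nat \<Rightarrow> ((nat \<Rightarrow>\<^sub>0 nat) \<Rightarrow>\<^sub>0 'k::field) set \<Rightarrow> ((nat \<Rightarrow>\<^sub>0 nat) \<Rightarrow>\<^sub>0 'k) list \<Rightarrow> bool" where
  "system_of_parameters n I fs \<longleftrightarrow>
    (\<forall>f\<in>set fs. f \<in> carrier (mpoly_ring n) \<and> homogeneous f) \<and>
    enat (length fs) = krull_dim (mpoly_ring n Quot I) \<and>
    radical (mpoly_ring n) (genideal (mpoly_ring n) (I \<union> set fs)) = irrelevant_ideal n"

definition linear_form :: "'k::field mat \<Rightarrow> nat \<Rightarrow> (nat \<Rightarrow>\<^sub>0 nat) \<Rightarrow>\<^sub>0 'k" where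
  "linear_form A i = (\<Sum>j<dim_col A. const (A $$ (i, j)) * var j)"

definition prime_submatrix :: "'k::field mat \<Rightarrow> ((nat \<Rightarrow>\<^sub>0 nat) \<Rightarrow>\<^sub>0 'k) set \<Rightarrow> 'k mat" where
  "prime_submatrix A P = submatrix A UNIV {j. var j \<notin> P}"

definition full_column_rank :: "'k::field mat \<Rightarrow> bool" where
  "full_column_rank B \<longleftrightarrow> vec_space.rank (dim_row B) B = dim_col B"

end

(*
For a set T of variables let P_T be the ideal they generate, i.e. the polynomials all of whose
monomials involve a variable from T.  Every P_T is prime, and a prime containing a monomial ideal I
contains P_T for T its set of variables, while P_T still contains I; so the minimal primes of I are
the minimal P_T containing I.

Upper bound ht(P_T) <= |T|: given primes P_0 < ... < P_r = P_T, choose f_i in P_i but not in P_{i-1}.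
Working down the chain, the products of monomials in the variables outside T with powers of
f_1, ..., f_r are linearly independent modulo P_0.  Bounding all exponents by N gives about
N^(n - |T| + r) independent polynomials whose exponents are O(N), hence inside a space of dimension
O(N^n), and so r <= |T|.

Rank criterion: a vector w in the kernel of A_P, extended by 0, is a common zero of P and the f_i, so
rad(I, f_1, ..., f_d) = m forces w = 0.  Conversely, if some f in m had no power in (I, f_1, ..., f_d),
there would be a prime Q containing this ideal, a minimal prime P of I inside Q, and a variable x_j
outside Q.  A K-linear functional that vanishes on Q and is 1 at x_j then yields, by its values at the
variables, a nonzero vector in the kernel of A_P.
*)
theory Submission
  imports Defs "HOL-Algebra.Ring_Divisibility"
begin

section \<open>Ideals of the polynomial ring\<close>

lemma mpoly_ring_simps [simp]:
  "monoid.mult (mpoly_ring n) = (*)"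
  "monoid.one (mpoly_ring n) = 1"
  "ring.zero (mpoly_ring n) = 0"
  "ring.add (mpoly_ring n) = (+)"
  by (simp_all add: mpoly_ring_def)

abbreviation polys :: "nat \<Rightarrow> ((nat \<Rightarrow>\<^sub>0 nat) \<Rightarrow>\<^sub>0 'k::field) set" where
  "polys n \<equiv> carrier (mpoly_ring n)"

lemma in_polys_iff:
  "f \<in> polys n \<longleftrightarrow> (\<forall>u\<in>Poly_Mapping.keys f. Poly_Mapping.keys u \<subseteq> {..<n})"
  by (simp add: mpoly_ring_def)

lemma keys_uminus_mpoly: "Poly_Mapping.keys (- f) = Poly_Mapping.keys (f :: 'a \<Rightarrow>\<^sub>0 'b::ab_group_add)"
  by (auto simp: in_keys_iff)

lemma keys_add_nat:
  "Poly_Mapping.keys (u + v) = Poly_Mapping.keys u \<union> Poly_Mapping.keys (v :: 'a \<Rightarrow>\<^sub>0 nat)"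
  by (auto simp: in_keys_iff lookup_add)

lemma keys_diff_nat: "Poly_Mapping.keys (u - v) \<subseteq> Poly_Mapping.keys (u :: 'a \<Rightarrow>\<^sub>0 nat)"
  by (rule subsetI, rule ccontr) (simp add: in_keys_iff lookup_minus)

lemma poly_mapping_eq_sum_single:
  fixes f :: "'a \<Rightarrow>\<^sub>0 'b::comm_monoid_add"
  assumes "finite K" "Poly_Mapping.keys f \<subseteq> K"
  shows "f = (\<Sum>u\<in>K. Poly_Mapping.single u (Poly_Mapping.lookup f u))"
proof (rule poly_mapping_eqI)
  fix w
  have "(\<Sum>u\<in>K. Poly_Mapping.lookup (Poly_Mapping.single u (Poly_Mapping.lookup f u)) w)
      = (\<Sum>u\<in>K. if u = w then Poly_Mapping.lookup f w else 0)"
    by (intro sum.cong) (auto simp: lookup_single when_def)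
  also have "\<dots> = Poly_Mapping.lookup f w"
    using assms by (auto simp: in_keys_iff)
  finally show "Poly_Mapping.lookup f w =
      Poly_Mapping.lookup (\<Sum>u\<in>K. Poly_Mapping.single u (Poly_Mapping.lookup f u)) w"
    by (simp add: lookup_sum)
qed

lemma polys_add: "f \<in> polys n \<Longrightarrow> g \<in> polys n \<Longrightarrow> f + g \<in> polys n"
  using keys_add[of f g] by (auto simp: in_polys_iff)

lemma polys_mult: "f \<in> polys n \<Longrightarrow> g \<in> polys n \<Longrightarrow> f * g \<in> polys n"
  using keys_mult[of f g] by (fastforce simp: in_polys_iff keys_add_nat)

lemma polys_uminus: "f \<in> polys n \<Longrightarrow> - f \<in> polys n"
  by (simp add: in_polys_iff keys_uminus_mpoly)

lemma polys_single: "Poly_Mapping.keys u \<subseteq> {..<n} \<Longrightarrow> Poly_Mapping.single u c \<in> polys n"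
  by (simp add: in_polys_iff)

lemma polys_const: "const c \<in> polys n"
  by (simp add: in_polys_iff const_def)

lemma polys_monomial: "Poly_Mapping.keys u \<subseteq> {..<n} \<Longrightarrow> monomial u \<in> polys n"
  unfolding monomial_def by (rule polys_single)

lemma polys_var: "j < n \<Longrightarrow> var j \<in> polys n"
  unfolding var_def by (rule polys_monomial) simp

lemma polys_one: "1 \<in> polys n"
  by (simp add: in_polys_iff)

lemma polys_zero: "0 \<in> polys n"
  by (simp add: in_polys_iff)

lemma polys_power: "f \<in> polys n \<Longrightarrow> f ^ k \<in> polys n"
  by (induction k) (simp_all only: power_0 power_Suc polys_one polys_mult)

section \<open>Ring structure, ideals and primes in terms of elements\<close>

lemma cring_mpoly_ring: "cring (mpoly_ring n :: ((nat \<Rightarrow>\<^sub>0 nat) \<Rightarrow>\<^sub>0 'k::field) ring)"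
proof (intro cringI abelian_groupI comm_monoidI)
  fix x :: "(nat \<Rightarrow>\<^sub>0 nat) \<Rightarrow>\<^sub>0 'k"
  assume "x \<in> polys n"
  then show "\<exists>y\<in>polys n. y \<oplus>\<^bsub>mpoly_ring n\<^esub> x = \<zero>\<^bsub>mpoly_ring n\<^esub>"
    using polys_uminus[of x n] by (intro bexI[of _ "- x"]) (simp_all)
qed (simp_all only: mpoly_ring_simps polys_add polys_mult polys_zero polys_one, simp_all add: algebra_simps)

interpretation mpoly_ring: cring "mpoly_ring n" for n
  by (rule cring_mpoly_ring)

lemma mpoly_ring_power [simp]: "f [^]\<^bsub>mpoly_ring n\<^esub> (k::nat) = f ^ k"
  by (induction k) (simp_all add: mult.commute)

text \<open>Negatives come for free: \<open>- a\<close> is the product of \<open>a\<close> with the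
  ring element \<open>- 1\<close>.\<close>

lemma mpoly_idealI:
  fixes J :: "((nat \<Rightarrow>\<^sub>0 nat) \<Rightarrow>\<^sub>0 'k::field) set"
  assumes "J \<subseteq> polys n" "0 \<in> J"
    and "\<And>a b. a \<in> J \<Longrightarrow> b \<in> J \<Longrightarrow> a + b \<in> J"
    and "\<And>a f. a \<in> J \<Longrightarrow> f \<in> polys n \<Longrightarrow> f * a \<in> J"
  shows "ideal J (mpoly_ring n)"
proof (rule idealI)
  have "- a \<in> J" if "a \<in> J" for a
    using assms(4)[OF that polys_uminus[OF polys_one]] by simp
  moreover have "inv\<^bsub>add_monoid (mpoly_ring n)\<^esub> a = - a" if "a \<in> J" for a
    using that assms(1) polys_uminus[of a n] mpoly_ring.minus_equality[of n "- a" a] by (auto simp: a_inv_def)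
  ultimately show "subgroup J (add_monoid (mpoly_ring n))"
    using assms by (auto simp: subgroup_def)
qed (use assms mpoly_ring.ring_axioms in \<open>auto simp: mult.commute\<close>)

context
  fixes n :: nat and J :: "((nat \<Rightarrow>\<^sub>0 nat) \<Rightarrow>\<^sub>0 'k::field) set"
  assumes ideal: "ideal J (mpoly_ring n)"
begin

lemma mpoly_ideal_sub: "J \<subseteq> polys n"
  using ideal.Icarr[OF ideal] by auto

lemma mpoly_ideal_zero: "0 \<in> J"
  using additive_subgroup.zero_closed[OF ideal.axioms(1)[OF ideal]] by simp

lemma mpoly_ideal_add: "a \<in> J \<Longrightarrow> b \<in> J \<Longrightarrow> a + b \<in> J"
  using additive_subgroup.a_closed[OF ideal.axioms(1)[OF ideal]] by simp

lemma mpoly_ideal_mult: "a \<in> J \<Longrightarrow> f \<in> polys n \<Longrightarrow> f * a \<in> J"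
  using ideal.I_l_closed[OF ideal] by simp

lemma mpoly_ideal_diff: "a \<in> J \<Longrightarrow> b \<in> J \<Longrightarrow> a - b \<in> J"
  using mpoly_ideal_add[of a "- 1 * b"] mpoly_ideal_mult[OF _ polys_uminus[OF polys_one], of b]
  by simp

lemma mpoly_ideal_sum: "(\<And>i. i \<in> A \<Longrightarrow> g i \<in> J) \<Longrightarrow> sum g A \<in> J"
  by (induction A rule: infinite_finite_induct) (auto simp: mpoly_ideal_zero mpoly_ideal_add)

end

lemma mpoly_primeD:
  assumes "primeideal Q (mpoly_ring n)"
  shows "ideal Q (mpoly_ring n)" "1 \<notin> Q"
    "a \<in> polys n \<Longrightarrow> b \<in> polys n \<Longrightarrow> a * b \<in> Q \<Longrightarrow> a \<in> Q \<or> b \<in> Q"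
  using assms primeideal.I_prime[OF assms] primeideal.axioms(1)[OF assms]
    ideal.one_imp_carrier[of Q "mpoly_ring n"] primeideal.I_notcarr[OF assms]
  by auto

lemma mpoly_prime_power:
  assumes "primeideal Q (mpoly_ring n)" "a \<in> polys n" "a ^ k \<in> Q"
  shows "a \<in> Q"
  using assms(3)
proof (induction k)
  case 0
  then show ?case using mpoly_primeD(2)[OF assms(1)] by simp
next
  case (Suc k)
  then show ?case
    using mpoly_primeD(3)[OF assms(1) assms(2) polys_power[OF assms(2)]] by auto
qed

section \<open>Monomials in prime ideals, and primes generated by variables\<close>

lemma single_add_mult: "Poly_Mapping.single (u + w) c = Poly_Mapping.single u c * monomial w"
  by (simp add: monomial_def mult_single)

lemma monomial_single:
  "monomial (Poly_Mapping.single j b) = (var j ^ b :: (nat \<Rightarrow>\<^sub>0 nat) \<Rightarrow>\<^sub>0 'k::field)"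
proof (induction b)
  case (Suc b)
  have "Poly_Mapping.single j (Suc b) = Poly_Mapping.single j 1 + (Poly_Mapping.single j b :: nat \<Rightarrow>\<^sub>0 nat)"
    by (simp add: single_add[symmetric])
  then have "monomial (Poly_Mapping.single j (Suc b)) =
      (var j * monomial (Poly_Mapping.single j b) :: (nat \<Rightarrow>\<^sub>0 nat) \<Rightarrow>\<^sub>0 'k)"
    by (simp only: monomial_def var_def mult_single mult_1)
  then show ?case using Suc by simp
qed (simp add: monomial_def)

text \<open>A monomial is a product of powers of variables. The induction splits off one power
  \<open>var a ^ b\<close> at a time, and primality passes membership to one of the factors.\<close>

lemma prime_contains_var_of_monomial:
  assumes Q: "primeideal Q (mpoly_ring n)"
    and "Poly_Mapping.keys u \<subseteq> {..<n}" "monomial u \<in> Q"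
  shows "\<exists>j\<in>Poly_Mapping.keys u. var j \<in> Q"
  using assms(2,3)
proof (induction u rule: update_induct)
  case const
  then show ?case using mpoly_primeD(2)[OF Q] by (simp add: monomial_def)
next
  case (update u a b)
  have upd: "Poly_Mapping.update a b u = u + Poly_Mapping.single a b"
    using update(1) by (intro poly_mapping_eqI)
      (auto simp: lookup_update lookup_add lookup_single when_def in_keys_iff)
  have keys: "Poly_Mapping.keys (Poly_Mapping.update a b u) = insert a (Poly_Mapping.keys u)"
    using update(2) by (auto simp: upd keys_add_nat)
  then have a: "a < n" and u: "Poly_Mapping.keys u \<subseteq> {..<n}" using update(4) by auto
  have "monomial u * var a ^ b \<in> Q"
    using update(5) unfolding upd monomial_def[of "u + _"]
    by (simp add: single_add_mult flip: monomial_single) (simp add: monomial_def)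
  then have "monomial u \<in> Q \<or> var a ^ b \<in> Q"
    by (intro mpoly_primeD(3)[OF Q] polys_monomial polys_power polys_var u a)
  then show ?case
    using update(3)[OF u] mpoly_prime_power[OF Q polys_var[OF a]] unfolding keys by blast
qed

text \<open>This is the ideal P_T. Describing it by supports instead of generators lets membership
  be checked monomial by monomial; \<open>var_ideal_minimal\<close> recovers generation by the
  variables. Indices in \<open>T\<close> from \<open>n\<close> on have no effect.\<close>

definition var_ideal :: "nat \<Rightarrow> nat set \<Rightarrow> ((nat \<Rightarrow>\<^sub>0 nat) \<Rightarrow>\<^sub>0 'k::field) set" where
  "var_ideal n T = {f \<in> polys n. \<forall>u\<in>Poly_Mapping.keys f. Poly_Mapping.keys u \<inter> T \<noteq> {}}"

lemma var_ideal_ideal: "ideal (var_ideal n T) (mpoly_ring n)"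
proof (rule mpoly_idealI)
  fix a b f :: "(nat \<Rightarrow>\<^sub>0 nat) \<Rightarrow>\<^sub>0 'k::field"
  assume a: "a \<in> var_ideal n T"
  show "a + b \<in> var_ideal n T" if "b \<in> var_ideal n T"
    using a that polys_add[of a n b] keys_add[of a b]
    unfolding var_ideal_def by (auto)
  show "f * a \<in> var_ideal n T" if "f \<in> polys n"
    using a that polys_mult[of f n a] keys_mult[of f a]
    unfolding var_ideal_def by (fastforce simp: keys_add_nat)
qed (auto simp: var_ideal_def in_polys_iff)

text \<open>Setting the variables in \<open>T\<close> to 0 changes a polynomial only by an element
  of the ideal. So the claim reduces to polynomials free of these variables, where a product lies in
  the ideal only if it is 0, and there are no zero divisors.\<close>

lemma var_ideal_prime: "primeideal (var_ideal n T) (mpoly_ring n :: ((nat \<Rightarrow>\<^sub>0 nat) \<Rightarrow>\<^sub>0 'k::field) ring)"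
proof (rule primeidealI[OF var_ideal_ideal cring_mpoly_ring])
  have "1 \<notin> var_ideal n T" by (simp add: var_ideal_def)
  then show "polys n \<noteq> (var_ideal n T :: ((nat \<Rightarrow>\<^sub>0 nat) \<Rightarrow>\<^sub>0 'k) set)" using polys_one by blast
next
  fix a b :: "(nat \<Rightarrow>\<^sub>0 nat) \<Rightarrow>\<^sub>0 'k"
  assume ab: "a \<in> polys n" "b \<in> polys n" "a \<otimes>\<^bsub>mpoly_ring n\<^esub> b \<in> var_ideal n T"
  \<comment> \<open>\<open>part f\<close> is \<open>f\<close> with the variables in \<open>T\<close> set to 0.\<close>
  define part where "part f = (\<Sum>u\<in>{u \<in> Poly_Mapping.keys f. Poly_Mapping.keys u \<inter> T = {}}.
      Poly_Mapping.single u (Poly_Mapping.lookup f u))" for f :: "(nat \<Rightarrow>\<^sub>0 nat) \<Rightarrow>\<^sub>0 'k"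
  have lookup_part: "Poly_Mapping.lookup (part f) w =
      (if Poly_Mapping.keys w \<inter> T = {} then Poly_Mapping.lookup f w else 0)" for f w
  proof -
    have "Poly_Mapping.lookup (part f) w = (\<Sum>u\<in>{u \<in> Poly_Mapping.keys f. Poly_Mapping.keys u \<inter> T = {}}.
        if u = w then Poly_Mapping.lookup f w else 0)"
      unfolding part_def lookup_sum by (intro sum.cong) (auto simp: lookup_single when_def)
    also have "\<dots> = (if w \<in> Poly_Mapping.keys f \<and> Poly_Mapping.keys w \<inter> T = {}
        then Poly_Mapping.lookup f w else 0)"
      by (subst sum.delta) auto
    finally show ?thesis by (simp add: in_keys_iff)
  qed
  have keys_part: "Poly_Mapping.keys (part f) = {u \<in> Poly_Mapping.keys f. Poly_Mapping.keys u \<inter> T = {}}" for f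
    unfolding in_keys_iff set_eq_iff lookup_part mem_Collect_eq by simp
  have part_carrier: "part f \<in> polys n" if "f \<in> polys n" for f
    using that by (auto simp: in_polys_iff keys_part)
  have rest: "f - part f \<in> var_ideal n T" if "f \<in> polys n" for f
    using that by (auto simp: var_ideal_def in_polys_iff in_keys_iff lookup_minus lookup_part split: if_splits)
  have part_zero: "f \<in> var_ideal n T" if "f \<in> polys n" "part f = 0" for f
    using rest[OF that(1)] that(2) by simp
  have "part a * part b = a * b - (b * (a - part a) + part a * (b - part b))"
    by (simp add: algebra_simps)
  also have "\<dots> \<in> var_ideal n T"
    by (rule mpoly_ideal_diff[OF var_ideal_ideal])
      (use ab in \<open>simp, intro mpoly_ideal_add[OF var_ideal_ideal]
        mpoly_ideal_mult[OF var_ideal_ideal] rest part_carrier ab(1,2)\<close>)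
  finally have in_ideal: "part a * part b \<in> var_ideal n T" .
  \<comment> \<open>Monomials of the product are products of monomials free of \<open>T\<close>,
    whereas membership makes each of them meet \<open>T\<close>; so there are none.\<close>
  have "Poly_Mapping.keys (part a * part b) = {}"
    using in_ideal keys_mult[of "part a" "part b"] by (fastforce simp: var_ideal_def keys_part keys_add_nat)
  then have "part a * part b = 0" by simp
  then show "a \<in> var_ideal n T \<or> b \<in> var_ideal n T"
    using part_zero ab by (metis mult_eq_0_iff)
qed

lemma var_in_var_ideal_iff [simp]: "var j \<in> var_ideal n T \<longleftrightarrow> j < n \<and> j \<in> T"
  by (auto simp: var_ideal_def var_def monomial_def in_polys_iff)

lemma monomial_in_var_ideal_iff:
  "Poly_Mapping.keys u \<subseteq> {..<n} \<Longrightarrow> monomial u \<in> var_ideal n T \<longleftrightarrow> Poly_Mapping.keys u \<inter> T \<noteq> {}"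
  by (auto simp: var_ideal_def monomial_def in_polys_iff)

text \<open>Every term of a member is a multiple of some variable from \<open>T\<close>, and an
  ideal containing these variables contains the sum of the terms.\<close>

lemma var_ideal_minimal:
  fixes J :: "((nat \<Rightarrow>\<^sub>0 nat) \<Rightarrow>\<^sub>0 'k::field) set"
  assumes J: "ideal J (mpoly_ring n)" and T: "\<And>j. j \<in> T \<Longrightarrow> j < n \<Longrightarrow> var j \<in> J"
  shows "var_ideal n T \<subseteq> J"
proof
  fix f :: "(nat \<Rightarrow>\<^sub>0 nat) \<Rightarrow>\<^sub>0 'k"
  assume f: "f \<in> var_ideal n T"
  have "Poly_Mapping.single u (Poly_Mapping.lookup f u) \<in> J" if u: "u \<in> Poly_Mapping.keys f" for u
  proof -
    obtain j where j: "j \<in> Poly_Mapping.keys u" "j \<in> T" using f u by (fastforce simp: var_ideal_def)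
    have un: "Poly_Mapping.keys u \<subseteq> {..<n}" using f u by (auto simp: var_ideal_def in_polys_iff)
    \<comment> \<open>Subtraction of exponents is truncated; adding back restores \<open>u\<close>
      because the exponent of \<open>j\<close> in it is positive.\<close>
    have split: "u = (u - Poly_Mapping.single j 1) + Poly_Mapping.single j 1"
    proof (rule poly_mapping_eqI)
      fix i
      show "Poly_Mapping.lookup u i =
          Poly_Mapping.lookup ((u - Poly_Mapping.single j 1) + Poly_Mapping.single j 1) i"
        using j(1) by (cases "i = j") (simp_all add: lookup_add lookup_minus lookup_single in_keys_iff)
    qed
    have "Poly_Mapping.keys (u - Poly_Mapping.single j 1) \<subseteq> {..<n}"
      by (rule subset_trans[OF keys_diff_nat un])
    then have "Poly_Mapping.single (u - Poly_Mapping.single j 1) (Poly_Mapping.lookup f u) * var j \<in> J"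
      using j un by (intro mpoly_ideal_mult[OF J] T polys_single) auto
    then show ?thesis
      using split single_add_mult[of "u - Poly_Mapping.single j 1" "Poly_Mapping.single j 1"]
      by (metis var_def)
  qed
  then have "(\<Sum>u\<in>Poly_Mapping.keys f. Poly_Mapping.single u (Poly_Mapping.lookup f u)) \<in> J"
    by (rule mpoly_ideal_sum[OF J])
  then show "f \<in> J"
    using poly_mapping_eq_sum_single[of "Poly_Mapping.keys f" f] by simp
qed

lemma var_ideal_subset_iff:
  assumes "T \<subseteq> {..<n}"
  shows "(var_ideal n T :: ((nat \<Rightarrow>\<^sub>0 nat) \<Rightarrow>\<^sub>0 'k::field) set) \<subseteq> var_ideal n T' \<longleftrightarrow> T \<subseteq> T'"
proof
  assume "(var_ideal n T :: ((nat \<Rightarrow>\<^sub>0 nat) \<Rightarrow>\<^sub>0 'k) set) \<subseteq> var_ideal n T'"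
  then have "var j \<in> (var_ideal n T' :: ((nat \<Rightarrow>\<^sub>0 nat) \<Rightarrow>\<^sub>0 'k) set)" if "j \<in> T" for j
    using that assms by (metis in_mono lessThan_iff var_in_var_ideal_iff)
  then show "T \<subseteq> T'" using var_in_var_ideal_iff by blast
qed (auto simp: var_ideal_def)

section \<open>Heights of primes generated by variables\<close>

text \<open>Linear independence, over the field, of the images in the quotient by \<open>P\<close>.
  It is stated for families, so that with \<open>P\<close> an ideal a repeated polynomial counts as
  a dependence.\<close>

definition indep_mod ::
    "((nat \<Rightarrow>\<^sub>0 nat) \<Rightarrow>\<^sub>0 'k::field) set \<Rightarrow> 'i set \<Rightarrow> ('i \<Rightarrow> (nat \<Rightarrow>\<^sub>0 nat) \<Rightarrow>\<^sub>0 'k) \<Rightarrow> bool" where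
  "indep_mod P J g \<longleftrightarrow> (\<forall>c. (\<Sum>j\<in>J. const (c j) * g j) \<in> P \<longrightarrow> (\<forall>j\<in>J. c j = 0))"

lemma const_zero [simp]: "const 0 = 0"
  and const_one [simp]: "const 1 = 1"
  and const_add: "const (a + b) = const a + const b"
  and const_mult: "const (a * b) = const a * const b"
  and const_uminus: "const (- a) = - const a"
  by (simp_all add: const_def single_add mult_single single_uminus)

lemma const_mult_monomial: "const c * monomial u = Poly_Mapping.single u c"
  by (simp add: const_def monomial_def mult_single)

text \<open>Allows initial segments of the naturals as index sets, so that only the number of
  polynomials has to be followed down a chain.\<close>

lemma indep_mod_reindex:
  assumes "indep_mod P J g" and h: "bij_betw h J' J"
  shows "indep_mod P J' (\<lambda>i. g (h i))"
  unfolding indep_mod_def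
proof (intro allI impI ballI)
  fix c i
  assume sum: "(\<Sum>i\<in>J'. const (c i) * g (h i)) \<in> P" and i: "i \<in> J'"
  define c' where "c' = c \<circ> inv_into J' h"
  have inv: "c' (h i) = c i" if "i \<in> J'" for i
    using that h by (simp add: c'_def bij_betw_inv_into_left)
  have "(\<Sum>j\<in>J. const (c' j) * g j) = (\<Sum>i\<in>J'. const (c' (h i)) * g (h i))"
    by (rule sum.reindex_bij_betw[OF h, symmetric])
  also have "\<dots> = (\<Sum>i\<in>J'. const (c i) * g (h i))"
    by (rule sum.cong) (simp_all add: inv)
  finally show "c i = 0"
    using assms(1)[unfolded indep_mod_def, rule_format, of c' "h i"] sum i inv[OF i] bij_betwE[OF h]
    by simp
qed

text \<open>
  Reduction modulo \<open>Q\<close> isolates the part of a relation without \<open>f\<close>, whose coefficients therefore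
  vanish; the rest is divisible by \<open>f\<close>, which can be cancelled modulo the prime \<open>P\<close>.
\<close>

lemma indep_mod_powers:
  fixes g :: "'i \<Rightarrow> (nat \<Rightarrow>\<^sub>0 nat) \<Rightarrow>\<^sub>0 'k::field"
  assumes P: "primeideal P (mpoly_ring n)" and Q: "ideal Q (mpoly_ring n)" and "P \<subseteq> Q"
    and f: "f \<in> Q" "f \<notin> P"
    and g: "\<And>j. j \<in> J \<Longrightarrow> g j \<in> polys n" and indep: "indep_mod Q J g"
  shows "indep_mod P (J \<times> {..<N}) (\<lambda>(j, i). g j * f ^ i)"
proof (induction N)
  case (Suc N)
  have fn: "f \<in> polys n" using mpoly_ideal_sub[OF Q] f by blast
  show ?case
    unfolding indep_mod_def
  proof (intro allI impI ballI)
    fix c x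
    assume sum: "(\<Sum>x\<in>J \<times> {..<Suc N}. const (c x) * (case x of (j, i) \<Rightarrow> g j * f ^ i)) \<in> P"
      and x: "x \<in> J \<times> {..<Suc N}"
    define low where "low = (\<Sum>j\<in>J. const (c (j, 0)) * g j)"
    \<comment> \<open>The remaining terms of the relation all contain \<open>f\<close>;
      \<open>high\<close> is what is left after one factor \<open>f\<close> is taken out, hence the
      shifted index \<open>Suc i\<close>.\<close>
    define high where
      "high = (\<Sum>x\<in>J \<times> {..<N}. const (case x of (j, i) \<Rightarrow> c (j, Suc i)) * (case x of (j, i) \<Rightarrow> g j * f ^ i))"
    have high_carrier: "high \<in> polys n"
      unfolding high_def using g fn
      by (intro mpoly_ideal_sum[OF mpoly_ring.oneideal])
        (auto intro!: polys_mult polys_const polys_power)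
    have "(\<Sum>x\<in>J \<times> {..<Suc N}. const (c x) * (case x of (j, i) \<Rightarrow> g j * f ^ i))
        = (\<Sum>j\<in>J. \<Sum>i<Suc N. const (c (j, i)) * (g j * f ^ i))"
      by (simp add: sum.cartesian_product case_prod_beta' del: sum.lessThan_Suc)
    also have "\<dots> = low + (\<Sum>j\<in>J. \<Sum>i<N. const (c (j, Suc i)) * (g j * f ^ Suc i))"
      by (simp add: sum.lessThan_Suc_shift sum.distrib low_def del: sum.lessThan_Suc)
    also have "(\<Sum>j\<in>J. \<Sum>i<N. const (c (j, Suc i)) * (g j * f ^ Suc i)) = high * f"
      by (simp add: high_def sum.cartesian_product case_prod_beta' sum_distrib_left mult_ac)
    finally have split: "low + high * f \<in> P" using sum by simp
    have "high * f \<in> Q"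
      by (rule mpoly_ideal_mult[OF Q f(1) high_carrier])
    then have "low \<in> Q"
      using split \<open>P \<subseteq> Q\<close> mpoly_ideal_diff[OF Q, of "low + high * f" "high * f"] by auto
    then have c0: "c (j, 0) = 0" if "j \<in> J" for j
      using indep[unfolded indep_mod_def, rule_format, of "\<lambda>j. c (j, 0)" j] that
      by (simp only: low_def)
    then have "low = 0" unfolding low_def by simp
    then have "high \<in> P"
      using mpoly_primeD(3)[OF P high_carrier fn] split f by auto
    then have "c (j, Suc i) = 0" if "j \<in> J" "i < N" for j i
      using Suc.IH[unfolded indep_mod_def, rule_format, of "\<lambda>(j, i). c (j, Suc i)" "(j, i)"] that
      unfolding high_def by auto
    then show "c x = 0"
      using c0 x by (cases x, cases "snd x") auto
  qed
qed (simp add: indep_mod_def)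

text \<open>Each exponent is bounded separately, not the total degree, so that in \<open>n\<close>
  variables the admissible exponent vectors fill a box of \<open>(B + 1) ^ n\<close> points.\<close>

definition exps_le :: "nat \<Rightarrow> ((nat \<Rightarrow>\<^sub>0 nat) \<Rightarrow>\<^sub>0 'k::field) \<Rightarrow> bool" where
  "exps_le B f \<longleftrightarrow> (\<forall>u\<in>Poly_Mapping.keys f. \<forall>j. Poly_Mapping.lookup u j \<le> B)"

lemma exps_le_mult: "exps_le B f \<Longrightarrow> exps_le C g \<Longrightarrow> exps_le (B + C) (f * g)"
  using keys_mult[of f g] by (fastforce simp: exps_le_def lookup_add intro: add_mono)

lemma exps_le_power: "exps_le D f \<Longrightarrow> exps_le (i * D) (f ^ i)"
  by (induction i) (simp add: exps_le_def, simp add: exps_le_mult)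

lemma exps_le_mono: "exps_le B f \<Longrightarrow> B \<le> C \<Longrightarrow> exps_le C f"
  unfolding exps_le_def using order_trans by blast

lemma exps_le_exists: "\<exists>D. exps_le D f"
proof
  let ?S = "\<Union>u\<in>Poly_Mapping.keys f. Poly_Mapping.range u"
  \<comment> \<open>The added 0 is the exponent of an absent variable, which \<open>range\<close>
    omits, and keeps the maximum defined when \<open>f\<close> is 0.\<close>
  show "exps_le (Max (insert 0 ?S)) f"
    unfolding exps_le_def
  proof (intro ballI allI)
    fix u j
    assume u: "u \<in> Poly_Mapping.keys f"
    have "finite (insert 0 ?S)" by simp
    moreover have "Poly_Mapping.lookup u j \<in> insert 0 ?S"
      using u in_keys_lookup_in_range[of j u]
      by (cases "j \<in> Poly_Mapping.keys u") (blast, simp add: in_keys_iff)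
    ultimately show "Poly_Mapping.lookup u j \<le> Max (insert 0 ?S)" by (rule Max_ge)
  qed
qed

text \<open>Going down one prime with \<open>indep_mod_powers\<close> multiplies the number of
  polynomials by \<open>N\<close> and raises exponents by at most \<open>N\<close> times a bound for
  the chosen \<open>f\<close>. What matters is that \<open>D\<close> depends on the chain alone, so
  \<open>N\<close>, \<open>m\<close> and \<open>B\<close> can be chosen after it.\<close>

lemma prime_chain_indep_mod:
  assumes "prime_chain (mpoly_ring n) Ps"
  shows "\<exists>D. \<forall>(N::nat) (m::nat) B g. indep_mod (last Ps) {..<m} g \<and> (\<forall>i<m. g i \<in> polys n \<and> exps_le B (g i)) \<longrightarrow>
    (\<exists>g'. indep_mod (hd Ps) {..<m * N ^ (length Ps - 1)} g' \<and>
      (\<forall>i < m * N ^ (length Ps - 1). g' i \<in> polys n \<and> exps_le (B + N * D) (g' i)))"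
proof -
  have "Ps \<noteq> []" using assms by (simp add: prime_chain_def)
  then show ?thesis using assms
  proof (induction Ps rule: list_nonempty_induct)
    case (single P)
    then show ?case by (intro exI[of _ 0]) auto
  next
    case (cons P Ps)
    have chain: "prime_chain (mpoly_ring n) Ps" and P: "primeideal P (mpoly_ring n)"
      and Q: "ideal (hd Ps) (mpoly_ring n)" and strict: "P \<subset> hd Ps"
      using cons.prems cons.hyps mpoly_primeD(1)[of "hd Ps" n] by (auto simp: prime_chain_def)
    from cons.IH[OF chain] obtain D where IH: "\<And>(N::nat) (m::nat) B g. indep_mod (last Ps) {..<m} g \<Longrightarrow>
        (\<forall>i<m. g i \<in> polys n \<and> exps_le B (g i)) \<Longrightarrow>
        (\<exists>g'. indep_mod (hd Ps) {..<m * N ^ (length Ps - 1)} g' \<and>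
          (\<forall>i < m * N ^ (length Ps - 1). g' i \<in> polys n \<and> exps_le (B + N * D) (g' i)))"
      by blast
    obtain f where f: "f \<in> hd Ps" "f \<notin> P" using strict by blast
    obtain D' where D': "exps_le D' f" using exps_le_exists by blast
    show ?case
    proof (intro exI[of _ "D + D'"] allI impI, elim conjE)
      fix N m B :: nat and g :: "nat \<Rightarrow> (nat \<Rightarrow>\<^sub>0 nat) \<Rightarrow>\<^sub>0 'a"
      assume "indep_mod (last (P # Ps)) {..<m} g" and "\<forall>i<m. g i \<in> polys n \<and> exps_le B (g i)"
      then have "\<exists>g'. indep_mod (hd Ps) {..<m * N ^ (length Ps - 1)} g' \<and>
          (\<forall>i < m * N ^ (length Ps - 1). g' i \<in> polys n \<and> exps_le (B + N * D) (g' i))"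
        using cons.hyps by (intro IH) auto
      then obtain g' where g': "indep_mod (hd Ps) {..<m * N ^ (length Ps - 1)} g'"
        "\<And>i. i < m * N ^ (length Ps - 1) \<Longrightarrow> g' i \<in> polys n"
        "\<And>i. i < m * N ^ (length Ps - 1) \<Longrightarrow> exps_le (B + N * D) (g' i)"
        by blast
      let ?M = "m * N ^ (length Ps - 1)"
      let ?g = "\<lambda>(j, i). g' j * f ^ i"
      \<comment> \<open>As the tail is nonempty, the truncated \<open>length - 1\<close> really
        grows by one, which accounts for the new factor \<open>N\<close>.\<close>
      have len: "m * N ^ (length (P # Ps) - 1) = card ({..<?M} \<times> {..<N})"
        using cons.hyps by (cases Ps) (simp_all add: mult_ac)
      obtain h where h: "bij_betw h {..<m * N ^ (length (P # Ps) - 1)} ({..<?M} \<times> {..<N})"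
        using ex_bij_betw_nat_finite[of "{..<?M} \<times> {..<N}"] unfolding len
        by (metis atLeast0LessThan finite_cartesian_product finite_lessThan)
      have "indep_mod P ({..<?M} \<times> {..<N}) ?g"
        by (rule indep_mod_powers[OF P Q _ f _ g'(1)]) (use strict g'(2) in auto)
      then have "indep_mod P {..<m * N ^ (length (P # Ps) - 1)} (\<lambda>i. ?g (h i))"
        by (rule indep_mod_reindex[OF _ h])
      moreover have "?g (h k) \<in> polys n \<and> exps_le (B + N * (D + D')) (?g (h k))"
        if "k < m * N ^ (length (P # Ps) - 1)" for k
      proof -
        have "h k \<in> {..<?M} \<times> {..<N}"
          using bij_betwE[OF h] that by (simp only: lessThan_iff)
        then obtain j i where ji: "h k = (j, i)" "j < ?M" "i < N" by (elim SigmaE) (simp only: lessThan_iff)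
        have "exps_le (B + N * D + i * D') (g' j * f ^ i)"
          by (intro exps_le_mult g'(3) ji exps_le_power D')
        then have "exps_le (B + N * (D + D')) (g' j * f ^ i)"
          by (rule exps_le_mono) (use ji(3) in \<open>simp add: algebra_simps\<close>)
        moreover have "g' j * f ^ i \<in> polys n"
          using mpoly_ideal_sub[OF Q] f by (intro polys_mult g'(2) ji polys_power) auto
        ultimately show ?thesis using ji(1) by simp
      qed
      ultimately show "\<exists>g'. indep_mod (hd (P # Ps)) {..<m * N ^ (length (P # Ps) - 1)} g' \<and>
          (\<forall>i < m * N ^ (length (P # Ps) - 1). g' i \<in> polys n \<and> exps_le (B + N * (D + D')) (g' i))"
        by (intro exI[of _ "\<lambda>i. ?g (h i)"]) (simp only: list.sel simp_thms, blast)
    qed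
  qed
qed

section \<open>Counting independent polynomials with bounded exponents\<close>

definition exp_box :: "nat set \<Rightarrow> nat \<Rightarrow> (nat \<Rightarrow>\<^sub>0 nat) set" where
  "exp_box C B = {u. Poly_Mapping.keys u \<subseteq> C \<and> (\<forall>j. Poly_Mapping.lookup u j \<le> B)}"

text \<open>Exponents outside \<open>C\<close> are 0, whereas functions in \<open>PiE\<close> are
  \<open>undefined\<close> there; restriction and summation of single exponents translate between
  the two.\<close>

lemma exp_box_bij:
  assumes "finite C"
  shows "bij_betw (\<lambda>u. restrict (Poly_Mapping.lookup u) C) (exp_box C B) (PiE C (\<lambda>_. {..B}))"
proof (rule bij_betw_byWitness[where f' = "\<lambda>w. \<Sum>j\<in>C. Poly_Mapping.single j (w j)"])
  have lookup: "Poly_Mapping.lookup (\<Sum>j\<in>C. Poly_Mapping.single j (w j)) i = (if i \<in> C then w i else 0)"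
    for w :: "nat \<Rightarrow> nat" and i
    using assms by (auto simp: lookup_sum lookup_single when_def)
  show "\<forall>u\<in>exp_box C B. (\<Sum>j\<in>C. Poly_Mapping.single j (restrict (Poly_Mapping.lookup u) C j)) = u"
    by (auto simp: exp_box_def lookup in_keys_iff subset_iff intro!: poly_mapping_eqI)
  show "\<forall>w\<in>PiE C (\<lambda>_. {..B}).
      restrict (Poly_Mapping.lookup (\<Sum>j\<in>C. Poly_Mapping.single j (w j))) C = w"
    by (auto simp: fun_eq_iff lookup restrict_def PiE_def extensional_def)
  show "(\<lambda>u. restrict (Poly_Mapping.lookup u) C) ` exp_box C B \<subseteq> PiE C (\<lambda>_. {..B})"
    by (auto simp: exp_box_def)
  show "(\<lambda>w. \<Sum>j\<in>C. Poly_Mapping.single j (w j)) ` PiE C (\<lambda>_. {..B}) \<subseteq> exp_box C B"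
    by (auto simp: exp_box_def lookup in_keys_iff PiE_def Pi_def split: if_splits)
qed

lemma finite_exp_box: "finite C \<Longrightarrow> finite (exp_box C B)"
  using bij_betw_finite[OF exp_box_bij] by (simp add: finite_PiE)

lemma card_exp_box: "finite C \<Longrightarrow> card (exp_box C B) = Suc B ^ card C"
  using bij_betw_same_card[OF exp_box_bij] by (simp add: card_PiE)

interpretation mpoly_space: vector_space "\<lambda>c f. const c * f"
  by unfold_locales (simp_all add: const_add const_mult algebra_simps)

text \<open>As \<open>0 \<in> P\<close>, independence modulo \<open>P\<close> implies plain linear
  independence, and the polynomials lie in the span of the \<open>(B + 1) ^ n\<close> monomials with
  exponents up to \<open>B\<close>.\<close>

lemma indep_mod_card_le:
  assumes indep: "indep_mod P J g" and "finite J" "0 \<in> P"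
    and g: "\<And>j. j \<in> J \<Longrightarrow> g j \<in> polys n" "\<And>j. j \<in> J \<Longrightarrow> exps_le B (g j)"
  shows "card J \<le> Suc B ^ n"
proof -
  have inj: "inj_on g J"
  proof (rule inj_onI, rule ccontr)
    fix i j assume ij: "i \<in> J" "j \<in> J" "g i = g j" "i \<noteq> j"
    \<comment> \<open>Coefficients 1 at \<open>i\<close> and -1 at \<open>j\<close> turn equal
      members into a nontrivial relation.\<close>
    let ?c = "\<lambda>k. if k = i then 1 else if k = j then - 1 else 0"
    have "(\<Sum>k\<in>J. const (?c k) * g k)
        = (\<Sum>k\<in>J. (if k = i then g k else 0) + (if k = j then - g k else 0))"
      using ij by (intro sum.cong) (auto simp: const_uminus)
    also have "\<dots> = 0"
      using ij \<open>finite J\<close> by (simp add: sum.distrib)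
    finally show False
      using indep[unfolded indep_mod_def, rule_format, of ?c i] ij \<open>0 \<in> P\<close> by simp
  qed
  have indep': "mpoly_space.independent (g ` J)"
  proof (rule mpoly_space.independent_if_scalars_zero)
    fix c v
    assume sum: "(\<Sum>v\<in>g ` J. const (c v) * v) = 0" and v: "v \<in> g ` J"
    have "(\<Sum>j\<in>J. const (c (g j)) * g j) = 0"
      using sum by (simp add: sum.reindex[OF inj])
    then have "(\<Sum>j\<in>J. const (c (g j)) * g j) \<in> P"
      using \<open>0 \<in> P\<close> by simp
    moreover obtain j where "j \<in> J" "v = g j" using v by blast
    ultimately show "c v = 0"
      using indep[unfolded indep_mod_def, rule_format, of "\<lambda>j. c (g j)" j] by simp
  qed (simp add: \<open>finite J\<close>)
  have span: "g ` J \<subseteq> mpoly_space.span (monomial ` exp_box {..<n} B)"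
  proof clarify
    fix j assume j: "j \<in> J"
    have "g j = (\<Sum>u\<in>Poly_Mapping.keys (g j). const (Poly_Mapping.lookup (g j) u) * monomial u)"
      unfolding const_mult_monomial by (rule poly_mapping_eq_sum_single) simp_all
    also have "\<dots> \<in> mpoly_space.span (monomial ` exp_box {..<n} B)"
      using g[OF j] by (intro mpoly_space.span_sum mpoly_space.span_scale mpoly_space.span_base)
        (auto simp: exp_box_def exps_le_def in_polys_iff)
    finally show "g j \<in> mpoly_space.span (monomial ` exp_box {..<n} B)" .
  qed
  have "card (g ` J) \<le> card (monomial ` exp_box {..<n} B :: ((nat \<Rightarrow>\<^sub>0 nat) \<Rightarrow>\<^sub>0 'a) set)"
    using mpoly_space.independent_span_bound[OF finite_imageI indep' span]
      finite_exp_box[of "{..<n}" B] by simp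
  also have "\<dots> \<le> card (exp_box {..<n} B)"
    by (rule card_image_le) (simp add: finite_exp_box)
  finally show ?thesis
    by (simp add: card_exp_box card_image[OF inj])
qed

section \<open>Length of chains below a prime generated by variables\<close>

lemma monomials_indep_mod_var_ideal:
  assumes "finite E" and "\<And>u. u \<in> E \<Longrightarrow> Poly_Mapping.keys u \<inter> T = {}"
  shows "indep_mod (var_ideal n T) E monomial"
  unfolding indep_mod_def const_mult_monomial
proof (intro allI impI ballI)
  fix c u
  assume sum: "(\<Sum>u\<in>E. Poly_Mapping.single u (c u)) \<in> var_ideal n T" and u: "u \<in> E"
  have "Poly_Mapping.lookup (\<Sum>u\<in>E. Poly_Mapping.single u (c u)) u = c u"
    using u assms(1) by (simp add: lookup_sum lookup_single when_def)
  then show "c u = 0"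
    using sum assms(2)[OF u] by (auto simp: var_ideal_def in_keys_iff)
qed

text \<open>Feeds the \<open>(B + 1) ^ (n - card T)\<close> monomials in the variables outside
  \<open>T\<close> with exponents up to \<open>B\<close> into the chain. A chain that is too long
  would produce more independent polynomials than the box of the resulting exponents allows.\<close>

lemma prime_chain_length_le:
  assumes chain: "prime_chain (mpoly_ring n :: ((nat \<Rightarrow>\<^sub>0 nat) \<Rightarrow>\<^sub>0 'k::field) ring) Ps"
    and last: "last Ps = var_ideal n T" and T: "T \<subseteq> {..<n}"
  shows "length Ps - 1 \<le> card T"
proof (rule ccontr)
  assume len: "\<not> length Ps - 1 \<le> card T"
  obtain D where D: "\<forall>(N::nat) (m::nat) B g.
      indep_mod (last Ps) {..<m} g \<and> (\<forall>i<m. g i \<in> polys n \<and> exps_le B (g i)) \<longrightarrow>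
      (\<exists>g'. indep_mod (hd Ps) {..<m * N ^ (length Ps - 1)} g' \<and>
        (\<forall>i < m * N ^ (length Ps - 1). g' i \<in> polys n \<and> exps_le (B + N * D) (g' i)))"
    using prime_chain_indep_mod[OF chain] by (rule exE)
  define C where "C = {..<n} - T"
  have C: "finite C" "card C = n - card T" and cT: "card T \<le> n"
    using T card_mono[OF _ T] by (auto simp: C_def card_Diff_subset finite_subset)
  \<comment> \<open>\<open>?N\<close> exceeds \<open>(D + 1)\<^sup>n\<close>, so \<open>?N\<^sup>n\<^sup>+\<^sup>1 \<le> (?N * (D + 1))\<^sup>n\<close> is impossible.\<close>
  define B where "B = (D + 1) ^ n"
  let ?N = "Suc B"
  let ?m = "?N ^ card C"
  obtain h where h: "bij_betw h {..<?m} (exp_box C B)"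
    using ex_bij_betw_nat_finite[OF finite_exp_box[OF C(1)], of B] card_exp_box[OF C(1), of B]
    by (auto simp: atLeast0LessThan)
  have box: "h i \<in> exp_box C B" if "i < ?m" for i
    using bij_betwE[OF h] that by auto
  have "indep_mod (last Ps) {..<?m} (\<lambda>i. monomial (h i))"
    unfolding last
    by (intro indep_mod_reindex[OF monomials_indep_mod_var_ideal h] finite_exp_box C(1))
      (auto simp: exp_box_def C_def)
  moreover have "\<forall>i<?m. monomial (h i) \<in> polys n \<and> exps_le B (monomial (h i))"
  proof (intro allI impI)
    fix i assume "i < ?m"
    then show "monomial (h i) \<in> polys n \<and> exps_le B (monomial (h i))"
      using box[of i] by (auto simp: exp_box_def C_def exps_le_def monomial_def in_polys_iff)
  qed
  ultimately have "\<exists>g'. indep_mod (hd Ps) {..<?m * ?N ^ (length Ps - 1)} g' \<and>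
      (\<forall>i < ?m * ?N ^ (length Ps - 1). g' i \<in> polys n \<and> exps_le (B + ?N * D) (g' i))"
    using D[THEN spec[of _ ?N], THEN spec[of _ ?m], THEN spec[of _ B],
        THEN spec[of _ "\<lambda>i. monomial (h i)"]] by (elim mp, intro conjI)
  then obtain g' where g': "indep_mod (hd Ps) {..<?m * ?N ^ (length Ps - 1)} g'"
      "\<And>i. i < ?m * ?N ^ (length Ps - 1) \<Longrightarrow> g' i \<in> polys n"
      "\<And>i. i < ?m * ?N ^ (length Ps - 1) \<Longrightarrow> exps_le (B + ?N * D) (g' i)"
    by blast
  have "primeideal (hd Ps) (mpoly_ring n)" using chain by (auto simp: prime_chain_def)
  then have zero: "0 \<in> hd Ps" by (intro mpoly_ideal_zero mpoly_primeD(1))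
  \<comment> \<open>By \<open>len\<close>, the exponent \<open>card C + (length Ps - 1)\<close> is
    at least \<open>n + 1\<close>, one more than the exponent \<open>n\<close> in the dimension
    bound.\<close>
  have "?N ^ n * ?N = ?N ^ Suc n" by simp
  also have "\<dots> \<le> ?N ^ (card C + (length Ps - 1))"
    by (rule power_increasing) (use len C cT in linarith, simp)
  also have "\<dots> = card {..<?m * ?N ^ (length Ps - 1)}"
    by (simp add: power_add)
  also have "\<dots> \<le> Suc (B + ?N * D) ^ n"
    by (rule indep_mod_card_le[OF g'(1) _ zero g'(2,3)]) simp_all
  also have "Suc (B + ?N * D) = ?N * (D + 1)" by simp
  also have "(?N * (D + 1)) ^ n = ?N ^ n * B"
    by (simp only: power_mult_distrib B_def)
  finally have "?N \<le> B" by simp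
  then show False by simp
qed

text \<open>The counting argument bounds the height from above. For the lower bound the variables in
  \<open>T\<close> are adjoined one at a time, which gives \<open>card T + 1\<close> primes.\<close>

lemma height_var_ideal:
  assumes T: "T \<subseteq> {..<n}"
  shows "height (mpoly_ring n :: ((nat \<Rightarrow>\<^sub>0 nat) \<Rightarrow>\<^sub>0 'k::field) ring) (var_ideal n T) = enat (card T)"
proof (rule antisym)
  show "height (mpoly_ring n :: ((nat \<Rightarrow>\<^sub>0 nat) \<Rightarrow>\<^sub>0 'k) ring) (var_ideal n T) \<le> enat (card T)"
    unfolding height_def using prime_chain_length_le T by (intro SUP_least) auto
next
  have "finite T" using T finite_subset by blast
  then obtain ts where ts: "set ts = T" "distinct ts" using finite_distinct_list by blast
  define Ps :: "((nat \<Rightarrow>\<^sub>0 nat) \<Rightarrow>\<^sub>0 'k) set list" where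
    "Ps = map (\<lambda>i. var_ideal n (set (take i ts))) [0..<Suc (length ts)]"
  have "sorted_wrt (\<subset>) Ps"
    unfolding Ps_def sorted_wrt_map
  proof (rule sorted_wrt_mono_rel[OF _ sorted_wrt_upt])
    fix i j assume ij: "i \<in> set [0..<Suc (length ts)]" "j \<in> set [0..<Suc (length ts)]" "i < j"
    have "set (take i ts) \<subseteq> set (take j ts)" using ij by (intro set_take_subset_set_take) simp
    \<comment> \<open>\<open>ts\<close> has no repetitions, so longer prefixes contain more
      variables; this makes the inclusions strict.\<close>
    moreover have "card (set (take i ts)) < card (set (take j ts))"
      using ij by (simp add: distinct_card[OF distinct_take[OF ts(2)]] del: upt_Suc)
    ultimately have "\<not> set (take j ts) \<subseteq> set (take i ts)" by auto
    moreover have "set (take i ts) \<subseteq> {..<n}" for i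
      using set_take_subset[of i ts] ts(1) T by blast
    ultimately show "(var_ideal n (set (take i ts)) :: ((nat \<Rightarrow>\<^sub>0 nat) \<Rightarrow>\<^sub>0 'k) set) \<subset> var_ideal n (set (take j ts))"
      using \<open>set (take i ts) \<subseteq> set (take j ts)\<close> by (simp add: less_le_not_le var_ideal_subset_iff)
  qed
  then have "prime_chain (mpoly_ring n) Ps"
    using var_ideal_prime by (auto simp: prime_chain_def Ps_def simp del: upt_Suc)
  moreover have "last Ps = var_ideal n T"
    using ts(1) by (simp add: Ps_def)
  moreover have "length Ps - 1 = card T"
    using ts by (simp add: Ps_def distinct_card[symmetric])
  ultimately show "enat (card T) \<le> height (mpoly_ring n :: ((nat \<Rightarrow>\<^sub>0 nat) \<Rightarrow>\<^sub>0 'k) ring) (var_ideal n T)"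
    unfolding height_def by (intro SUP_upper2[of Ps]) auto
qed

section \<open>Primes containing a monomial ideal\<close>

text \<open>The nontrivial half of the fact that the radical of \<open>J\<close> is the intersection
  of the primes over \<open>J\<close>; for \<open>a\<close> equal to 1 it yields a prime over a
  proper ideal.\<close>

lemma (in cring) prime_avoiding_powers:
  assumes J: "ideal J R" and a: "a \<in> carrier R" and powers: "\<And>k::nat. a [^] k \<notin> J"
  shows "\<exists>Q. primeideal Q R \<and> J \<subseteq> Q \<and> a \<notin> Q"
proof -
  \<comment> \<open>An ideal maximal among those containing no power of \<open>a\<close> is prime.\<close>
  define S where "S = {Q. ideal Q R \<and> J \<subseteq> Q \<and> (\<forall>k::nat. a [^] k \<notin> Q)}"
  have "\<exists>Q\<in>S. \<forall>X\<in>S. Q \<subseteq> X \<longrightarrow> X = Q"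
  proof (rule subset_Zorn_nonempty)
    show "S \<noteq> {}" using J powers by (auto simp: S_def)
    fix C assume C: "C \<noteq> {}" "subset.chain S C"
    then have "subset.chain {I. ideal I R} C"
      by (auto simp: subset.chain_def S_def)
    then have "ideal (\<Union>C) R" using chain_Union_is_ideal[of C] C(1) by simp
    then show "\<Union>C \<in> S"
      using C by (auto simp: S_def subset.chain_def)
  qed
  then obtain Q where QS: "Q \<in> S" and max: "\<And>X. X \<in> S \<Longrightarrow> Q \<subseteq> X \<Longrightarrow> X = Q" by blast
  then have Q: "ideal Q R" "J \<subseteq> Q" "\<And>k::nat. a [^] k \<notin> Q" by (auto simp: S_def)
  interpret Q: ideal Q R by (rule Q(1))
  \<comment> \<open>For \<open>x\<close> outside \<open>Q\<close>, the ideal generated by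
    \<open>Q\<close> and \<open>x\<close> is strictly larger, so by maximality it contains a power
    of \<open>a\<close>.\<close>
  have power_in_sum: "\<exists>(k::nat) q r. a [^] k = q \<oplus> r \<otimes> x \<and> q \<in> Q \<and> r \<in> carrier R"
    if x: "x \<in> carrier R" "x \<notin> Q" for x
  proof -
    have ideal: "ideal (Q <+> PIdl x) R"
      by (intro add_ideals Q(1) cgenideal_ideal x(1))
    have "Q \<subseteq> Q <+> PIdl x"
    proof
      fix q assume q: "q \<in> Q"
      moreover have "\<zero> \<in> PIdl x"
        using cgenideal_ideal[OF x(1)] by (simp add: additive_subgroup.zero_closed ideal.axioms(1))
      ultimately have "q \<oplus> \<zero> \<in> Q <+> PIdl x"
        unfolding set_add_def' by blast
      then show "q \<in> Q <+> PIdl x" using Q.Icarr[OF q] by simp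
    qed
    moreover have "\<zero> \<oplus> x \<in> Q <+> PIdl x"
      unfolding set_add_def' using cgenideal_self[OF x(1)] Q.zero_closed by blast
    then have "x \<in> Q <+> PIdl x" using x(1) by simp
    ultimately have "Q <+> PIdl x \<notin> S" using max x(2) by blast
    then obtain k :: nat where "a [^] k \<in> Q <+> PIdl x"
      using ideal \<open>Q \<subseteq> Q <+> PIdl x\<close> Q(2) by (auto simp: S_def)
    then show ?thesis unfolding set_add_def' cgenideal_def by blast
  qed
  have "primeideal Q R"
  proof (rule primeidealI[OF Q(1) is_cring])
    show "carrier R \<noteq> Q" using Q(3)[of 0] by auto
    fix x y assume x: "x \<in> carrier R" and y: "y \<in> carrier R" and xy: "x \<otimes> y \<in> Q"
    show "x \<in> Q \<or> y \<in> Q"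
    proof (rule ccontr)
      assume "\<not> (x \<in> Q \<or> y \<in> Q)"
      then obtain k l :: nat and q r p s where
        k: "a [^] k = q \<oplus> r \<otimes> x" "q \<in> Q" "r \<in> carrier R" and
        l: "a [^] l = p \<oplus> s \<otimes> y" "p \<in> Q" "s \<in> carrier R"
        using power_in_sum[OF x] power_in_sum[OF y] by blast
      have carr: "q \<in> carrier R" "p \<in> carrier R" using k l Q.Icarr by auto
      \<comment> \<open>Every term of the expanded product contains \<open>q\<close>,
        \<open>p\<close> or \<open>x \<otimes> y\<close>, so this power of \<open>a\<close> would
        lie in \<open>Q\<close>.\<close>
      have "a [^] (k + l) = (q \<oplus> r \<otimes> x) \<otimes> (p \<oplus> s \<otimes> y)"
        using a by (simp add: nat_pow_mult[symmetric] k l)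
      also have "\<dots> = (p \<oplus> s \<otimes> y) \<otimes> q \<oplus> ((r \<otimes> x) \<otimes> p \<oplus> (r \<otimes> s) \<otimes> (x \<otimes> y))"
        using carr k l x y by (simp add: l_distr r_distr m_ac)
      also have "\<dots> \<in> Q"
        by (intro Q.a_closed Q.I_l_closed[OF xy] Q.I_l_closed[OF k(2)] Q.I_l_closed[OF l(2)])
          (use carr k(3) l(3) x y in simp_all)
      finally show False using Q(3) by blast
    qed
  qed
  moreover have "a \<notin> Q" using Q(3)[of 1] a by simp
  ultimately show ?thesis using Q(2) by blast
qed

section \<open>Minimal primes of a monomial ideal\<close>

lemma monomial_ideal_generators:
  assumes "monomial_ideal n I"
  shows "\<exists>M. (\<forall>u\<in>M. Poly_Mapping.keys u \<subseteq> {..<n} \<and> monomial u \<in> I) \<and>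
    (\<forall>Q. ideal Q (mpoly_ring n) \<and> monomial ` M \<subseteq> Q \<longrightarrow> I \<subseteq> Q)"
proof -
  obtain M where M: "\<forall>u\<in>M. Poly_Mapping.keys u \<subseteq> {..<n}"
      "I = genideal (mpoly_ring n) (monomial ` M)"
    using assms by (auto simp: monomial_ideal_def)
  have carr: "monomial ` M \<subseteq> polys n" using M(1) by (intro image_subsetI polys_monomial) simp
  have "monomial ` M \<subseteq> I"
    unfolding M(2) by (rule mpoly_ring.genideal_self[OF carr])
  moreover have "I \<subseteq> Q" if "ideal Q (mpoly_ring n)" "monomial ` M \<subseteq> Q" for Q
    unfolding M(2) by (rule mpoly_ring.genideal_minimal[OF that])
  ultimately show ?thesis
    using M(1) by (intro exI[of _ M]) auto
qed

text \<open>\<open>Q\<close> contains each generating monomial of \<open>I\<close>, hence by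
  primality one of its variables; the monomial therefore already lies in the ideal of the variables
  in \<open>Q\<close>.\<close>

lemma prime_contains_var_ideal:
  assumes I: "monomial_ideal n I" and Q: "primeideal Q (mpoly_ring n)" and "I \<subseteq> Q"
  shows "I \<subseteq> var_ideal n {j. j < n \<and> var j \<in> Q}" "var_ideal n {j. j < n \<and> var j \<in> Q} \<subseteq> Q"
proof -
  show "var_ideal n {j. j < n \<and> var j \<in> Q} \<subseteq> Q"
    by (rule var_ideal_minimal[OF mpoly_primeD(1)[OF Q]]) simp
  obtain M where M: "\<forall>u\<in>M. Poly_Mapping.keys u \<subseteq> {..<n} \<and> monomial u \<in> I"
    "\<forall>Q. ideal Q (mpoly_ring n) \<and> monomial ` M \<subseteq> Q \<longrightarrow> I \<subseteq> Q"
    using monomial_ideal_generators[OF I] by blast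
  have "monomial u \<in> var_ideal n {j. j < n \<and> var j \<in> Q}" if u: "u \<in> M" for u
  proof -
    have keys: "Poly_Mapping.keys u \<subseteq> {..<n}" and "monomial u \<in> Q"
      using M(1) u \<open>I \<subseteq> Q\<close> by auto
    then obtain j where "j \<in> Poly_Mapping.keys u" "var j \<in> Q"
      using prime_contains_var_of_monomial[OF Q keys] by blast
    then show ?thesis
      using keys by (auto simp: monomial_in_var_ideal_iff)
  qed
  then show "I \<subseteq> var_ideal n {j. j < n \<and> var j \<in> Q}"
    using M(2) var_ideal_ideal by blast
qed

text \<open>The prime of the variables in \<open>P\<close> lies between \<open>I\<close> and
  \<open>P\<close>, so minimality forces equality.\<close>

lemma minimal_prime_eq_var_ideal:
  assumes "monomial_ideal n I" "P \<in> minimal_primes (mpoly_ring n) I"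
  shows "P = var_ideal n {j. j < n \<and> var j \<in> P}"
  using prime_contains_var_ideal[of n I P] var_ideal_prime assms
  unfolding minimal_primes_def by blast

text \<open>Finitely many sets of variables are in question, so a minimal one exists. The resulting
  ideal is minimal among all primes over \<open>I\<close>, since each such prime contains one of the
  same kind.\<close>

lemma prime_contains_minimal_prime:
  assumes I: "monomial_ideal n I" and Q: "primeideal Q (mpoly_ring n)" and "I \<subseteq> Q"
  shows "\<exists>P\<in>minimal_primes (mpoly_ring n) I. P \<subseteq> Q"
proof -
  define T where "T = {j. j < n \<and> var j \<in> Q}"
  define F where "F = {T'. T' \<subseteq> T \<and> I \<subseteq> var_ideal n T'}"
  have "finite F" by (rule finite_subset[of _ "Pow T"]) (auto simp: F_def T_def)
  moreover have "T \<in> F" using prime_contains_var_ideal(1)[OF assms] by (simp add: F_def T_def)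
  ultimately obtain T' where T': "T' \<in> F" and min: "\<And>T''. T'' \<in> F \<Longrightarrow> T'' \<subseteq> T' \<Longrightarrow> T' = T''"
    using finite_has_minimal[of F] by blast
  have "P = var_ideal n T'"
    if P: "primeideal P (mpoly_ring n)" "I \<subseteq> P" "P \<subseteq> var_ideal n T'" for P
  proof -
    define T'' where "T'' = {j. j < n \<and> var j \<in> P}"
    have sub: "I \<subseteq> var_ideal n T''" "var_ideal n T'' \<subseteq> P"
      using prime_contains_var_ideal[OF I P(1,2)] by (simp_all add: T''_def)
    have "T'' \<subseteq> T'"
      using P(3) var_in_var_ideal_iff[of _ n T'] by (auto simp: T''_def)
    moreover from this have "T'' \<in> F" using T' sub by (auto simp: F_def)
    ultimately have "T' = T''" using min by blast
    then show ?thesis using sub P(3) by blast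
  qed
  then have "var_ideal n T' \<in> minimal_primes (mpoly_ring n) I"
    using T' var_ideal_prime by (auto simp: minimal_primes_def F_def)
  moreover have "var_ideal n T' \<subseteq> Q"
    using T' by (intro var_ideal_minimal mpoly_primeD(1)[OF Q]) (auto simp: F_def T_def)
  ultimately show ?thesis by blast
qed

section \<open>Point evaluations and linear functionals\<close>

definition eval_monomial :: "(nat \<Rightarrow> 'k::field) \<Rightarrow> (nat \<Rightarrow>\<^sub>0 nat) \<Rightarrow> 'k" where
  "eval_monomial v u = (\<Prod>j\<in>Poly_Mapping.keys u. v j ^ Poly_Mapping.lookup u j)"

definition eval_mpoly :: "(nat \<Rightarrow> 'k::field) \<Rightarrow> ((nat \<Rightarrow>\<^sub>0 nat) \<Rightarrow>\<^sub>0 'k) \<Rightarrow> 'k" where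
  "eval_mpoly v f = (\<Sum>u\<in>Poly_Mapping.keys f. Poly_Mapping.lookup f u * eval_monomial v u)"

lemma eval_monomial_superset:
  "finite F \<Longrightarrow> Poly_Mapping.keys u \<subseteq> F \<Longrightarrow> eval_monomial v u = (\<Prod>j\<in>F. v j ^ Poly_Mapping.lookup u j)"
  unfolding eval_monomial_def by (rule prod.mono_neutral_left) (auto simp: in_keys_iff)

lemma eval_monomial_add: "eval_monomial v (u + w) = eval_monomial v u * eval_monomial v w"
  by (simp add: eval_monomial_superset[of "Poly_Mapping.keys u \<union> Poly_Mapping.keys w"]
      keys_add_nat lookup_add power_add prod.distrib)

lemma eval_mpoly_superset:
  "finite F \<Longrightarrow> Poly_Mapping.keys f \<subseteq> F \<Longrightarrow>
    eval_mpoly v f = (\<Sum>u\<in>F. Poly_Mapping.lookup f u * eval_monomial v u)"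
  unfolding eval_mpoly_def by (rule sum.mono_neutral_left) (auto simp: in_keys_iff)

lemma eval_mpoly_add: "eval_mpoly v (f + g) = eval_mpoly v f + eval_mpoly v g"
  using keys_add[of f g]
  by (simp add: eval_mpoly_superset[of "Poly_Mapping.keys f \<union> Poly_Mapping.keys g"]
      lookup_add distrib_right sum.distrib)

lemma eval_mpoly_zero [simp]: "eval_mpoly v 0 = 0"
  by (simp add: eval_mpoly_def)

lemma eval_mpoly_single: "eval_mpoly v (Poly_Mapping.single u c) = c * eval_monomial v u"
  by (simp add: eval_mpoly_def)

lemma eval_mpoly_sum: "eval_mpoly v (sum g A) = (\<Sum>i\<in>A. eval_mpoly v (g i))"
  by (induction A rule: infinite_finite_induct) (simp_all add: eval_mpoly_add)

lemma eval_mpoly_mult: "eval_mpoly v (f * g) = eval_mpoly v f * eval_mpoly v g"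
proof -
  let ?F = "Poly_Mapping.keys f" and ?G = "Poly_Mapping.keys g"
  have "f * g = (\<Sum>u\<in>?F. Poly_Mapping.single u (Poly_Mapping.lookup f u)) *
      (\<Sum>w\<in>?G. Poly_Mapping.single w (Poly_Mapping.lookup g w))"
    using poly_mapping_eq_sum_single[of ?F f] poly_mapping_eq_sum_single[of ?G g] by simp
  also have "\<dots> = (\<Sum>u\<in>?F. \<Sum>w\<in>?G.
      Poly_Mapping.single (u + w) (Poly_Mapping.lookup f u * Poly_Mapping.lookup g w))"
    by (simp add: sum_product mult_single)
  finally show ?thesis
    by (simp add: eval_mpoly_sum eval_mpoly_single eval_monomial_add eval_mpoly_def[of v f]
        eval_mpoly_def[of v g] sum_product mult_ac)
qed

lemma eval_mpoly_power: "eval_mpoly v (f ^ k) = eval_mpoly v f ^ k"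
proof (induction k)
  case 0
  show ?case
    using eval_mpoly_single[of v 0 1] by (simp add: eval_monomial_def)
qed (simp add: eval_mpoly_mult)

lemma eval_mpoly_const [simp]: "eval_mpoly v (const c) = c"
  by (simp add: const_def eval_mpoly_single eval_monomial_def)

lemma eval_mpoly_var [simp]: "eval_mpoly v (var j) = v j"
  by (simp add: var_def monomial_def eval_mpoly_single eval_monomial_def)

lemma eval_mpoly_linear_form: "eval_mpoly v (linear_form A i) = (\<Sum>j<dim_col A. A $$ (i, j) * v j)"
  by (simp add: linear_form_def eval_mpoly_sum eval_mpoly_mult)

lemma eval_mpoly_vanishing_ideal: "ideal {f \<in> polys n. eval_mpoly v f = 0} (mpoly_ring n)"
  by (rule mpoly_idealI)
    (auto simp: eval_mpoly_add eval_mpoly_mult polys_add polys_mult polys_zero)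

text \<open>A basis of \<open>W\<close> stays independent when \<open>x\<close> is added, so values
  on it may be prescribed: 0 on the basis, 1 at \<open>x\<close>.\<close>

lemma linear_functional_separating:
  fixes scale :: "'k::field \<Rightarrow> 'b::ab_group_add \<Rightarrow> 'b"
  assumes "vector_space scale" "module.subspace scale W" "x \<notin> W"
  shows "\<exists>\<phi>. Vector_Spaces.linear scale (*) \<phi> \<and> (\<forall>w\<in>W. \<phi> w = 0) \<and> \<phi> x = 1"
proof -
  interpret vector_space_pair scale "(*) :: 'k \<Rightarrow> 'k \<Rightarrow> 'k"
    using assms(1) by (simp add: vector_space_pair_def) (unfold_locales, simp_all add: algebra_simps)
  obtain B where B: "B \<subseteq> W" "vs1.independent B" "W \<subseteq> vs1.span B"
    using vs1.maximal_independent_subset by blast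
  have span: "vs1.span B = W"
    using B assms(2) vs1.span_minimal by blast
  then have "vs1.independent (insert x B)"
    using B assms(3) by (intro vs1.independent_insertI) auto
  then obtain \<phi> where \<phi>: "Vector_Spaces.linear scale (*) \<phi>"
      "\<forall>y\<in>insert x B. \<phi> y = (if y = x then 1 else 0)"
    using linear_independent_extend[where f = "\<lambda>y. if y = x then 1 else 0"] by blast
  interpret \<phi>: Vector_Spaces.linear scale "(*)" \<phi> by (rule \<phi>(1))
  have "\<phi> w = 0" if "w \<in> W" for w
    by (rule \<phi>.eq_0_on_span[of B]) (use \<phi>(2) B(1) assms(3) that span in auto)
  then show ?thesis using \<phi> by auto
qed

section \<open>The rank criterion\<close>

text \<open>For distinct columns both conditions say that the set of columns is independent. A
  repeated column is lost in that set, so this case is separate: there both conditions fail.\<close>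

lemma full_column_rank_iff_kernel:
  "full_column_rank (B :: 'k::field mat) \<longleftrightarrow>
    (\<forall>v\<in>carrier_vec (dim_col B). B *\<^sub>v v = 0\<^sub>v (dim_row B) \<longrightarrow> v = 0\<^sub>v (dim_col B))"
proof -
  define nr nc where "nr = dim_row B" and "nc = dim_col B"
  have B: "B \<in> carrier_mat nr nc" by (simp add: nr_def nc_def)
  interpret vec_space "TYPE('k)" nr .
  show ?thesis
  proof (cases "distinct (cols B)")
    case True
    have "rank B = nc \<longleftrightarrow> lin_indpt (set (cols B))"
      using full_rank_lin_indpt[OF B _ True] lin_indpt_full_rank[OF B True] by blast
    also have "\<dots> \<longleftrightarrow> (\<forall>v\<in>carrier_vec nc. B *\<^sub>v v = 0\<^sub>v nr \<longrightarrow> v = 0\<^sub>v nc)"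
      using lin_depE[OF B _ True] lin_depI[OF B _ _ _ True] by metis
    finally show ?thesis by (simp add: full_column_rank_def nr_def nc_def)
  next
    case False
    have "rank B \<le> card (set (cols B))"
    proof -
      \<comment> \<open>\<open>S\<close> is a maximal independent set of columns; its size is the
        rank, which is therefore at most the number of distinct columns.\<close>
      obtain S where S: "maximal S (\<lambda>T. T \<subseteq> set (cols B) \<and> lin_indpt T)"
        using maximal_exists[of "(\<lambda>T. T \<subseteq> set (cols B) \<and> lin_indpt T)" "card (set (cols B))" "{}"]
        by (meson List.finite_set card_mono empty_iff empty_subsetI finite_lin_indpt2 rev_finite_subset)
      then show ?thesis
        using rank_card_indpt[OF B S] by (simp add: maximal_def card_mono)
    qed
    also have "card (set (cols B)) < nc"
      using False card_distinct[of "cols B"] card_length[of "cols B"] by (force simp: nc_def)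
    finally have not_full: "\<not> full_column_rank B"
      by (simp add: full_column_rank_def nr_def nc_def)
    obtain i j where ij: "i < nc" "j < nc" "i \<noteq> j" "col B i = col B j"
      using False by (auto simp: distinct_conv_nth nc_def)
    let ?v = "unit_vec nc i - unit_vec nc j :: 'k vec"
    have "?v $ i = 1" using ij by simp
    then have "?v \<noteq> 0\<^sub>v nc" using ij(1) by (metis index_zero_vec(1) zero_neq_one)
    moreover have "B *\<^sub>v ?v = 0\<^sub>v nr"
    proof (rule eq_vecI)
      fix r assume "r < dim_vec (0\<^sub>v nr :: 'k vec)"
      then have r: "r < nr" by simp
      then have "B $$ (r, i) = B $$ (r, j)"
        using ij index_col[of r B i] index_col[of r B j] by (simp add: nr_def nc_def)
      then show "(B *\<^sub>v ?v) $ r = 0\<^sub>v nr $ r"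
        using r ij B by (simp add: scalar_prod_minus_distrib[of _ nc])
    qed (use B in simp)
    moreover have "?v \<in> carrier_vec nc" by simp
    ultimately show ?thesis
      using not_full by (auto simp: nr_def nc_def)
  qed
qed

text \<open>\<open>pick S\<close> enumerates \<open>S\<close> in increasing order, hence
  injectively; counting gives surjectivity.\<close>

lemma bij_betw_pick:
  assumes "finite S"
  shows "bij_betw (pick S) {..<card S} S"
proof -
  have "inj_on (pick S) {..<card S}"
    using pick_mono_le by (intro linorder_inj_onI) (auto simp: less_imp_neq)
  moreover have "pick S ` {..<card S} \<subseteq> S" using pick_in_set_le by auto
  ultimately show ?thesis
    using card_image assms by (metis bij_betw_def card_lessThan card_subset_eq)
qed

text \<open>Kernel vectors become functions \<open>w\<close> on the original column indices, so that
  values attached to the variables can be used without renumbering columns.\<close>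

lemma full_column_rank_submatrix_iff:
  assumes A: "A \<in> carrier_mat d n"
  shows "full_column_rank (submatrix A UNIV J) \<longleftrightarrow>
    (\<forall>w. (\<forall>i<d. (\<Sum>j\<in>{j. j < n \<and> j \<in> J}. A $$ (i, j) * w j) = 0) \<longrightarrow> (\<forall>j<n. j \<in> J \<longrightarrow> w j = 0))"
proof -
  \<comment> \<open>\<open>J\<close> may be infinite, as it is for \<open>prime_submatrix\<close> at
    a prime, where it contains every index from \<open>n\<close> on; \<open>S\<close> keeps only the
    actual columns.\<close>
  define S where "S = {j. j < n \<and> j \<in> J}"
  define B where "B = submatrix A UNIV J"
  have fin: "finite S" by (simp add: S_def)
  have dims: "dim_row B = d" "dim_col B = card S"
    using A by (simp_all add: B_def S_def dim_submatrix)
  have index: "B $$ (i, l) = A $$ (i, pick S l)" if "i < d" "l < card S" for i l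
    using that A pick_reduce_set[of l n J] by (simp add: B_def S_def submatrix_index pick_UNIV)
  have pick: "bij_betw (pick S) {..<card S} S" by (rule bij_betw_pick[OF fin])
  have mult: "(B *\<^sub>v vec (card S) (\<lambda>l. w (pick S l))) $ i = (\<Sum>j\<in>S. A $$ (i, j) * w j)" if i: "i < d" for w i
  proof -
    have "(B *\<^sub>v vec (card S) (\<lambda>l. w (pick S l))) $ i = (\<Sum>l<card S. A $$ (i, pick S l) * w (pick S l))"
      using i dims by (auto simp: scalar_prod_def index atLeast0LessThan intro!: sum.cong)
    also have "\<dots> = (\<Sum>j\<in>S. A $$ (i, j) * w j)"
      by (rule sum.reindex_bij_betw[OF pick])
    finally show ?thesis .
  qed
  have zero_iff: "vec (card S) (\<lambda>l. w (pick S l)) = 0\<^sub>v (card S) \<longleftrightarrow> (\<forall>j\<in>S. w j = 0)" for w :: "nat \<Rightarrow> 'a"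
  proof -
    have "vec (card S) (\<lambda>l. w (pick S l)) = 0\<^sub>v (card S) \<longleftrightarrow> (\<forall>l\<in>{..<card S}. w (pick S l) = 0)"
      by (auto simp: vec_eq_iff)
    also have "\<dots> \<longleftrightarrow> (\<forall>j\<in>pick S ` {..<card S}. w j = 0)" by blast
    finally show ?thesis unfolding bij_betw_imp_surj_on[OF pick] .
  qed
  have kernel_iff: "B *\<^sub>v vec (card S) (\<lambda>l. w (pick S l)) = 0\<^sub>v d \<longleftrightarrow>
      (\<forall>i<d. (\<Sum>j\<in>S. A $$ (i, j) * w j) = 0)" for w
    using mult[of _ w] dims by (auto simp: vec_eq_iff simp del: index_mult_mat_vec)
  have vecs: "\<exists>w. v = vec (card S) (\<lambda>l. w (pick S l))" if "v \<in> carrier_vec (card S)" for v :: "'a vec"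
  proof
    \<comment> \<open>The witness for \<open>w\<close> is \<open>v\<close> composed with the inverse
      of the enumeration.\<close>
    show "v = vec (card S) (\<lambda>l. v $ inv_into {..<card S} (pick S) (pick S l))"
      using that pick by (auto simp: vec_eq_iff bij_betw_def inv_into_f_f)
  qed
  have "full_column_rank B \<longleftrightarrow>
      (\<forall>v\<in>carrier_vec (card S). B *\<^sub>v v = 0\<^sub>v d \<longrightarrow> v = 0\<^sub>v (card S))"
    unfolding full_column_rank_iff_kernel dims ..
  also have "\<dots> \<longleftrightarrow> (\<forall>w. B *\<^sub>v vec (card S) (\<lambda>l. w (pick S l)) = 0\<^sub>v d \<longrightarrow>
      vec (card S) (\<lambda>l. w (pick S l)) = 0\<^sub>v (card S))"
    using vecs vec_carrier by metis
  finally show ?thesis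
    unfolding kernel_iff zero_iff by (auto simp: B_def S_def)
qed

section \<open>Linear forms and the irrelevant ideal\<close>

lemma keys_linear_form:
  "Poly_Mapping.keys (linear_form A i) \<subseteq> (\<lambda>j. Poly_Mapping.single j 1) ` {..<dim_col A}"
proof -
  have "Poly_Mapping.keys (const c * var j) \<subseteq> {Poly_Mapping.single j 1}" for c :: 'a and j
    by (simp add: var_def const_mult_monomial)
  then show ?thesis
    unfolding linear_form_def using keys_sum[of "\<lambda>j. const (A $$ (i, j)) * var j" "{..<dim_col A}"] by blast
qed

lemma linear_form_in_var_ideal: "linear_form A i \<in> var_ideal (dim_col A) {..<dim_col A}"
proof -
  have "Poly_Mapping.keys u \<subseteq> {..<dim_col A} \<and> Poly_Mapping.keys u \<inter> {..<dim_col A} \<noteq> {}"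
    if u: "u \<in> Poly_Mapping.keys (linear_form A i)" for u
  proof -
    obtain j where "j < dim_col A" "u = Poly_Mapping.single j 1"
      using keys_linear_form[of A i] u by blast
    then show ?thesis by simp
  qed
  then show ?thesis unfolding var_ideal_def in_polys_iff by blast
qed

lemma homogeneous_linear_form: "homogeneous (linear_form A i)"
  unfolding homogeneous_def
proof (intro exI ballI)
  fix u assume "u \<in> Poly_Mapping.keys (linear_form A i)"
  then obtain j where "u = Poly_Mapping.single j 1" using keys_linear_form[of A i] by blast
  then show "mdeg u = 1" by (simp add: mdeg_def)
qed

lemma irrelevant_ideal_eq: "irrelevant_ideal n = var_ideal n {..<n}"
proof -
  have carr: "var ` {..<n} \<subseteq> polys n" by (intro image_subsetI polys_var) simp
  show ?thesis
    unfolding irrelevant_ideal_def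
  proof (rule antisym)
    show "genideal (mpoly_ring n) (var ` {..<n}) \<subseteq> var_ideal n {..<n}"
      by (rule mpoly_ring.genideal_minimal[OF var_ideal_ideal]) auto
    show "var_ideal n {..<n} \<subseteq> genideal (mpoly_ring n) (var ` {..<n})"
      using mpoly_ring.genideal_self[OF carr]
      by (intro var_ideal_minimal mpoly_ring.genideal_ideal[OF carr]) auto
  qed
qed

lemma monomial_ideal_ideal:
  assumes "monomial_ideal n I"
  shows "ideal I (mpoly_ring n)"
proof -
  obtain M where M: "\<forall>u\<in>M. Poly_Mapping.keys u \<subseteq> {..<n}"
      "I = genideal (mpoly_ring n) (monomial ` M)"
    using assms by (auto simp: monomial_ideal_def)
  show ?thesis
    unfolding M(2) using M(1) by (intro mpoly_ring.genideal_ideal image_subsetI polys_monomial) simp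
qed

text \<open>A proper ideal lies in some prime; the variables in that prime generate an ideal over
  \<open>I\<close> that is contained in the irrelevant ideal.\<close>

lemma proper_monomial_ideal_subset:
  assumes I: "monomial_ideal n I" and "I \<noteq> polys n"
  shows "I \<subseteq> var_ideal n {..<n}"
proof -
  have ideal: "ideal I (mpoly_ring n)" by (rule monomial_ideal_ideal[OF I])
  have "1 \<notin> I" using ideal.one_imp_carrier[OF ideal] assms(2) by auto
  then obtain Q where Q: "primeideal Q (mpoly_ring n)" "I \<subseteq> Q"
    using mpoly_ring.prime_avoiding_powers[OF ideal, of 1] polys_one by auto
  have "I \<subseteq> var_ideal n {j. j < n \<and> var j \<in> Q}"
    by (rule prime_contains_var_ideal(1)[OF I Q])
  also have "\<dots> \<subseteq> var_ideal n {..<n}" by (subst var_ideal_subset_iff) auto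
  finally show ?thesis .
qed

text \<open>Evaluation at the extended kernel vector kills \<open>I\<close> and the forms, so a
  power of \<open>var j\<close> in the ideal makes a power of that coordinate vanish.\<close>

lemma radical_imp_full_column_rank:
  assumes I: "monomial_ideal n I" and A: "A \<in> carrier_mat d n" and P: "P \<in> minimal_primes (mpoly_ring n) I"
    and rad: "var_ideal n {..<n} \<subseteq>
      radical (mpoly_ring n) (genideal (mpoly_ring n) (I \<union> linear_form A ` {..<d}))"
  shows "full_column_rank (prime_submatrix A P)"
  unfolding prime_submatrix_def full_column_rank_submatrix_iff[OF A]
proof (intro allI impI)
  fix w j
  assume ker: "\<forall>i<d. (\<Sum>j\<in>{j. j < n \<and> j \<in> {j. var j \<notin> P}}. A $$ (i, j) * w j) = 0"
    and j: "j < n" "j \<in> {j. var j \<notin> P}"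
  define v where "v j = (if var j \<in> P then 0 else w j)" for j
  let ?Z = "{f \<in> polys n. eval_mpoly v f = 0}"
  \<comment> \<open>It suffices to check generators: \<open>P\<close> is generated by its variables,
    at which \<open>v\<close> is 0 by definition.\<close>
  have "P \<subseteq> ?Z"
    by (subst minimal_prime_eq_var_ideal[OF I P], rule var_ideal_minimal[OF eval_mpoly_vanishing_ideal])
      (simp add: v_def polys_var)
  then have "I \<subseteq> ?Z" using P by (auto simp: minimal_primes_def)
  moreover have "linear_form A i \<in> ?Z" if i: "i < d" for i
  proof -
    have "(\<Sum>j<n. A $$ (i, j) * v j) = (\<Sum>j\<in>{j. j < n \<and> j \<in> {j. var j \<notin> P}}. A $$ (i, j) * w j)"
      by (rule sum.mono_neutral_cong_right) (auto simp: v_def)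
    then show ?thesis
      using ker i A linear_form_in_var_ideal[of A i]
      by (auto simp: eval_mpoly_linear_form var_ideal_def)
  qed
  ultimately have Z: "genideal (mpoly_ring n) (I \<union> linear_form A ` {..<d}) \<subseteq> ?Z"
    by (intro mpoly_ring.genideal_minimal[OF eval_mpoly_vanishing_ideal]) blast
  have "var j \<in> radical (mpoly_ring n) (genideal (mpoly_ring n) (I \<union> linear_form A ` {..<d}))"
    using rad j(1) by auto
  then obtain k where "var j ^ k \<in> genideal (mpoly_ring n) (I \<union> linear_form A ` {..<d})"
    by (auto simp: radical_def)
  then have "v j ^ k = 0" using Z by (auto simp: eval_mpoly_power)
  then show "w j = 0" using j(2) by (simp add: v_def)
qed

text \<open>\<open>Q\<close> need not have a zero with coordinates in the field. As the forms are
  linear, a linear functional on the polynomials can take the place of evaluation at a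
  point.\<close>

lemma full_column_rank_imp_radical:
  fixes I :: "((nat \<Rightarrow>\<^sub>0 nat) \<Rightarrow>\<^sub>0 'k::field) set"
  assumes I: "monomial_ideal n I" and A: "A \<in> carrier_mat d n"
    and rank: "\<And>P. P \<in> minimal_primes (mpoly_ring n) I \<Longrightarrow> full_column_rank (prime_submatrix A P)"
  shows "var_ideal n {..<n} \<subseteq>
      radical (mpoly_ring n) (genideal (mpoly_ring n) (I \<union> linear_form A ` {..<d}))"
proof
  fix f :: "(nat \<Rightarrow>\<^sub>0 nat) \<Rightarrow>\<^sub>0 'k"
  assume f: "f \<in> var_ideal n {..<n}"
  let ?G = "genideal (mpoly_ring n) (I \<union> linear_form A ` {..<d})"
  have fn: "f \<in> polys n" using f by (simp add: var_ideal_def)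
  have carr: "I \<union> linear_form A ` {..<d} \<subseteq> polys n"
    using mpoly_ideal_sub[OF monomial_ideal_ideal[OF I]] linear_form_in_var_ideal[of A] A
    by (auto simp: var_ideal_def)
  show "f \<in> radical (mpoly_ring n) ?G"
  proof (rule ccontr)
    assume "f \<notin> radical (mpoly_ring n) ?G"
    then have "f ^ k \<notin> ?G" for k using fn by (auto simp: radical_def)
    then obtain Q where Q: "primeideal Q (mpoly_ring n)" "?G \<subseteq> Q" "f \<notin> Q"
      using mpoly_ring.prime_avoiding_powers[OF mpoly_ring.genideal_ideal[OF carr] fn] by auto
    have QI: "I \<subseteq> Q" "\<And>i. i < d \<Longrightarrow> linear_form A i \<in> Q"
      using mpoly_ring.genideal_self[OF carr] Q(2) by auto
    have ideal: "ideal Q (mpoly_ring n)" by (rule mpoly_primeD(1)[OF Q(1)])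
    obtain P where P: "P \<in> minimal_primes (mpoly_ring n) I" "P \<subseteq> Q"
      using prime_contains_minimal_prime[OF I Q(1) QI(1)] by blast
    \<comment> \<open>If all variables were in \<open>Q\<close>, then so would be \<open>f\<close>,
      which has no constant term.\<close>
    obtain j where j: "j < n" "var j \<notin> Q"
      using var_ideal_minimal[OF ideal, of "{..<n}"] f Q(3) by auto
    have subspace: "mpoly_space.subspace Q"
      using mpoly_ideal_zero[OF ideal] mpoly_ideal_add[OF ideal]
        mpoly_ideal_mult[OF ideal _ polys_const]
      by (auto simp: mpoly_space.subspace_def)
    obtain \<phi> where \<phi>: "Vector_Spaces.linear (\<lambda>c f. const c * f) (*) \<phi>"
        "\<forall>f\<in>Q. \<phi> f = 0" "\<phi> (var j) = 1"
      using linear_functional_separating[OF mpoly_space.vector_space_axioms subspace j(2)] by blast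
    interpret \<phi>: Vector_Spaces.linear "\<lambda>c f. const c * f" "(*)" \<phi> by (rule \<phi>(1))
    have "(\<Sum>j\<in>{j. j < n \<and> j \<in> {j. var j \<notin> P}}. A $$ (i, j) * \<phi> (var j)) = 0" if i: "i < d" for i
    proof -
      \<comment> \<open>Terms with \<open>var j \<in> P\<close> drop out, because
        \<open>\<phi>\<close> vanishes on \<open>Q\<close>, which contains \<open>P\<close>.\<close>
      have "(\<Sum>j\<in>{j. j < n \<and> j \<in> {j. var j \<notin> P}}. A $$ (i, j) * \<phi> (var j))
          = (\<Sum>j<n. A $$ (i, j) * \<phi> (var j))"
        using \<phi>(2) P(2) by (intro sum.mono_neutral_left) auto
      also have "\<dots> = \<phi> (linear_form A i)"
        using A by (simp add: linear_form_def \<phi>.sum \<phi>.scale)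
      finally show ?thesis using \<phi>(2) QI(2)[OF i] by simp
    qed
    then have "\<forall>j<n. j \<in> {j. var j \<notin> P} \<longrightarrow> \<phi> (var j) = 0"
      by (intro rank[OF P(1), unfolded prime_submatrix_def full_column_rank_submatrix_iff[OF A],
          THEN spec[of _ "\<lambda>j. \<phi> (var j)"], THEN mp] allI impI)
    then have "\<phi> (var j) = 0" using j P(2) by auto
    then show False using \<phi>(3) by simp
  qed
qed

theorem theorem3p4:
  fixes n d :: nat
    and I :: "((nat \<Rightarrow>\<^sub>0 nat) \<Rightarrow>\<^sub>0 'k::field) set"
    and A :: "'k mat"
  assumes "monomial_ideal n I"
    and "I \<noteq> carrier (mpoly_ring n)"
    and "enat d = krull_dim (mpoly_ring n Quot I)"
    and "A \<in> carrier_mat d n"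
  shows "(\<forall>P\<in>minimal_primes (mpoly_ring n) I.
            dim_row (prime_submatrix A P) = d \<and>
            enat (dim_col (prime_submatrix A P)) = enat n - height (mpoly_ring n) P) \<and>
         (system_of_parameters n I (map (linear_form A) [0..<d]) \<longleftrightarrow>
          (\<forall>P\<in>minimal_primes (mpoly_ring n) I. full_column_rank (prime_submatrix A P)))"
proof (intro conjI ballI)
  fix P assume P: "P \<in> minimal_primes (mpoly_ring n) I"
  show "dim_row (prime_submatrix A P) = d"
    using assms(4) by (simp add: prime_submatrix_def dim_submatrix)
  define T where "T = {j. j < n \<and> var j \<in> P}"
  have T: "T \<subseteq> {..<n}" and PT: "P = var_ideal n T"
    using minimal_prime_eq_var_ideal[OF assms(1) P] by (auto simp: T_def)
  have "{j. j < dim_col A \<and> j \<in> {j. var j \<notin> P}} = {..<n} - T"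
    using assms(4) by (auto simp: T_def)
  then have "dim_col (prime_submatrix A P) = n - card T"
    using T by (simp add: prime_submatrix_def dim_submatrix card_Diff_subset finite_subset)
  then show "enat (dim_col (prime_submatrix A P)) = enat n - height (mpoly_ring n) P"
    unfolding PT height_var_ideal[OF T] by simp
next
  let ?G = "genideal (mpoly_ring n) (I \<union> linear_form A ` {..<d})"
  have set: "set (map (linear_form A) [0..<d]) = linear_form A ` {..<d}"
    by (simp add: atLeast0LessThan)
  have forms: "linear_form A i \<in> var_ideal n {..<n}" for i
    using linear_form_in_var_ideal[of A i] assms(4) by simp
  have G: "?G \<subseteq> var_ideal n {..<n}"
    using proper_monomial_ideal_subset[OF assms(1,2)] forms
    by (intro mpoly_ring.genideal_minimal[OF var_ideal_ideal]) auto
  \<comment> \<open>The irrelevant ideal is prime, hence contains the roots of its elements. This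
    inclusion holds whatever the rank, so the criterion concerns the reverse one.\<close>
  have sub: "radical (mpoly_ring n) ?G \<subseteq> var_ideal n {..<n}"
  proof
    fix f assume "f \<in> radical (mpoly_ring n) ?G"
    then obtain k where f: "f \<in> polys n" and "f ^ k \<in> ?G" by (auto simp: radical_def)
    then have "f ^ k \<in> var_ideal n {..<n}" using G by blast
    then show "f \<in> var_ideal n {..<n}" by (rule mpoly_prime_power[OF var_ideal_prime f])
  qed
  \<comment> \<open>Number and homogeneity of the forms are settled, \<open>d\<close> being the
    Krull dimension, so only the radical condition remains.\<close>
  have "system_of_parameters n I (map (linear_form A) [0..<d]) \<longleftrightarrow>
      radical (mpoly_ring n) ?G = var_ideal n {..<n}"
    using assms(3) forms homogeneous_linear_form[of A]
    unfolding system_of_parameters_def set irrelevant_ideal_eq by (auto simp: var_ideal_def)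
  then show "system_of_parameters n I (map (linear_form A) [0..<d]) \<longleftrightarrow>
      (\<forall>P\<in>minimal_primes (mpoly_ring n) I. full_column_rank (prime_submatrix A P))"
    using sub radical_imp_full_column_rank[OF assms(1,4)] full_column_rank_imp_radical[OF assms(1,4)]
    by (metis order_antisym_conv order_refl)
qed

end
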